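(* Let $1<p\le\infty$ and $1\le q<\infty$. For any measurable $\alpha:[0,1]\to[0,\infty)$ satisfying $\alpha(t)>0$ and $\alpha(t)>\left(\frac1p-\frac1q\right)_+$ for almost all $t\in[0,1]$, the operator $R^{\alpha(\cdot)}$ is bounded from $L_p[0,1]$ into $L_q[0,1]$.
   Context: For a measurable function $\alpha:[0,1]\to[0,\infty)$ with $\alpha(t)>0$ for almost every $t$, the Riemann--Liouville operator of variable order is $$(R^{\alpha(\cdot)}f)(t):=\frac{1}{\Gamma(\alpha(t))}\int_0^t (t-s)^{\alpha(t)-1}f(s)\,ds,\qquad t\in[0,1],$$ for $f\in L_1[0,1]$ (the integral exists for almost every $t$). Here $x_+=\max\{x,0\}$ and $1/\infty=0$. *)

theory Defs
  imports "HOL-Analysis.Analysis" "HOL-Probability.Essential_Supremum"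
begin

text \<open>
  Elements of \<open>L\<^sub>p\<close> are represented by functions; two functions agreeing almost everywhere represent
  the same element. The exponent is only meant to range over \<open>1 \<le> p \<le> \<infinity>\<close>.
\<close>

definition Lp_space :: "'a measure \<Rightarrow> ereal \<Rightarrow> ('a \<Rightarrow> real) set" where
  "Lp_space M p = {f \<in> borel_measurable M.
     if p = \<infinity> then esssup M (\<lambda>x. ereal \<bar>f x\<bar>) < \<infinity>
     else integrable M (\<lambda>x. \<bar>f x\<bar> powr real_of_ereal p)}"

definition Lp_norm :: "'a measure \<Rightarrow> ereal \<Rightarrow> ('a \<Rightarrow> real) \<Rightarrow> real" where
  "Lp_norm M p f =
     (if p = \<infinity> then real_of_ereal (esssup M (\<lambda>x. ereal \<bar>f x\<bar>))
      else (LINT x|M. \<bar>f x\<bar> powr real_of_ereal p) powr (1 / real_of_ereal p))"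

text \<open>
  Linearity is required only almost everywhere, i.e. on equivalence classes. Together with the norm
  bound it implies that the map respects equality almost everywhere.
\<close>

definition bounded_Lp_operator ::
  "'a measure \<Rightarrow> ereal \<Rightarrow> 'b measure \<Rightarrow> ereal \<Rightarrow> (('a \<Rightarrow> real) \<Rightarrow> ('b \<Rightarrow> real)) \<Rightarrow> bool" where
  "bounded_Lp_operator M p N q T \<longleftrightarrow>
     (\<forall>f\<in>Lp_space M p. T f \<in> Lp_space N q) \<and>
     (\<forall>f\<in>Lp_space M p. \<forall>g\<in>Lp_space M p. AE t in N. T (\<lambda>x. f x + g x) t = T f t + T g t) \<and>
     (\<forall>c. \<forall>f\<in>Lp_space M p. AE t in N. T (\<lambda>x. c * f x) t = c * T f t) \<and>
     (\<exists>C. \<forall>f\<in>Lp_space M p. Lp_norm N q (T f) \<le> C * Lp_norm M p f)"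

definition RL_integrand :: "(real \<Rightarrow> real) \<Rightarrow> (real \<Rightarrow> real) \<Rightarrow> real \<Rightarrow> real \<Rightarrow> real" where
  "RL_integrand \<alpha> f t s = (t - s) powr (\<alpha> t - 1) * f s"

text \<open>
  The Bochner integral is \<open>0\<close> when the integrand is not integrable, so existence of the integral has
  to be asserted separately (\<open>RL_exists\<close>).
\<close>

definition RL_exists :: "(real \<Rightarrow> real) \<Rightarrow> (real \<Rightarrow> real) \<Rightarrow> real \<Rightarrow> bool" where
  "RL_exists \<alpha> f t \<longleftrightarrow> integrable (lebesgue_on {0..t}) (RL_integrand \<alpha> f t)"

definition RL :: "(real \<Rightarrow> real) \<Rightarrow> (real \<Rightarrow> real) \<Rightarrow> real \<Rightarrow> real" where
  "RL \<alpha> f t = 1 / Gamma (\<alpha> t) * (LINT s|lebesgue_on {0..t}. RL_integrand \<alpha> f t s)"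

end

theory Submission
  imports Defs
begin

text \<open>
  Write \<open>M\<close> for the left-sided Hardy--Littlewood maximal function of \<open>\<bar>f\<bar>\<close>, extended by \<open>0\<close> outside
  \<open>{0..1}\<close>. The kernel \<open>(t - s) powr (a - 1)\<close> is, for \<open>0 < a < 1\<close>, a superposition of indicators
  of the intervals \<open>{t - h..t}\<close> (\<open>kernel_eq_average\<close>), and over such an interval \<open>\<bar>f\<bar>\<close> has
  integral at most \<open>h * M t\<close>. Hence the integral defining the operator is at most
  \<open>max 1 (1 / a) * M t\<close> (\<open>RL_nn_le_left_max\<close>). The factor \<open>1 / Gamma a\<close> absorbs \<open>1 / a\<close> uniformly
  in \<open>a > 0\<close> (\<open>Gamma_real_ge_inverse\<close>), so the operator is bounded pointwise by a constant
  multiple of \<open>M\<close>, whatever the variable order is. For finite \<open>p\<close> and \<open>q \<le> p\<close> this settles the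
  matter: \<open>M\<close> is bounded on \<open>L\<^sub>p\<close> as \<open>p > 1\<close> (\<open>left_max_strong_type\<close>), and on an interval of
  length \<open>1\<close> the \<open>L\<^sub>p\<close> norm controls the \<open>L\<^sub>q\<close> norm. The case \<open>p = \<infinity>\<close> reduces to a finite
  exponent that is at least \<open>q\<close>.

  If \<open>p < q\<close>, the order exceeds \<open>b = 1 / p - 1 / q > 0\<close> almost everywhere, and since \<open>t - s \<le> 1\<close>
  the kernel is dominated by the one of constant order \<open>b\<close>, with \<open>1 / Gamma (\<alpha> t)\<close> bounded. For
  that kernel Hedberg's argument (\<open>RL_nn_hedberg\<close>) estimates short intervals by \<open>M\<close> and long ones
  by the \<open>L\<^sub>p\<close> norm \<open>N\<close> of \<open>f\<close>; the optimal cut gives a bound by a multiple of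
  \<open>N powr (1 - p / q) * M t powr (p / q)\<close>, whose \<open>q\<close>-th power is integrable by the maximal inequality.

  Both cases are combined in \<open>RL_nn_majorant\<close>, for nonnegative Borel functions; passing to Borel
  representatives then gives the statement for Lebesgue measurable functions.
\<close>

section \<open>The left-sided maximal function\<close>

text \<open>
  The left-sided Hardy--Littlewood maximal function, with values in \<open>[0, \<infinity>]\<close>. Only rational
  lengths \<open>h\<close> enter, so that it is a countable supremum and measurability is immediate; averages
  over intervals of arbitrary length are still bounded by it (\<open>left_integral_le\<close>).
\<close>

definition left_max :: "(real \<Rightarrow> ennreal) \<Rightarrow> real \<Rightarrow> ennreal" where
  "left_max f t = (SUP h\<in>{h\<in>\<rat>. 0 < h}. (\<integral>\<^sup>+s\<in>{t-h..t}. f s \<partial>lborel) / ennreal h)"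

lemma borel_measurable_left_integral [measurable]:
  fixes f :: "real \<Rightarrow> ennreal"
  assumes [measurable]: "f \<in> borel_measurable borel"
  shows "(\<lambda>t. \<integral>\<^sup>+s\<in>{t-h..t}. f s \<partial>lborel) \<in> borel_measurable borel"
proof -
  have "(\<lambda>(t, s). f s * (if t - h \<le> s \<and> s \<le> t then 1 else 0)) \<in> borel_measurable (borel \<Otimes>\<^sub>M lborel)"
    by measurable
  also have "(\<lambda>(t, s). f s * (if t - h \<le> s \<and> s \<le> t then 1 else 0)) = (\<lambda>(t, s). f s * indicator {t-h..t} s)"
    by (auto simp: fun_eq_iff indicator_def)
  finally show ?thesis
    by (rule lborel.borel_measurable_nn_integral)
qed

lemma borel_measurable_left_max [measurable]:
  assumes [measurable]: "f \<in> borel_measurable borel"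
  shows "left_max f \<in> borel_measurable borel"
proof -
  have "countable {h\<in>\<rat>. 0 < (h::real)}"
    by (rule countable_subset[OF _ countable_rat]) auto
  then have "(\<lambda>t. SUP h\<in>{h\<in>\<rat>. 0 < h}. (\<integral>\<^sup>+s\<in>{t-h..t}. f s \<partial>lborel) / ennreal h) \<in> borel_measurable borel"
    by (intro borel_measurable_SUP) measurable
  then show ?thesis
    by (simp add: left_max_def[abs_def])
qed

lemma left_integral_le_rat:
  assumes "h \<in> \<rat>" "0 < h"
  shows "(\<integral>\<^sup>+s\<in>{t-h..t}. f s \<partial>lborel) \<le> ennreal h * left_max f t"
proof -
  have "(\<integral>\<^sup>+s\<in>{t-h..t}. f s \<partial>lborel) = ennreal h * ((\<integral>\<^sup>+s\<in>{t-h..t}. f s \<partial>lborel) / ennreal h)"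
    using assms by (subst ennreal_times_divide, subst mult.commute) (simp add: ennreal_mult_divide_eq)
  also have "\<dots> \<le> ennreal h * left_max f t"
    unfolding left_max_def by (intro mult_left_mono SUP_upper) (use assms in auto)
  finally show ?thesis .
qed

lemma left_integral_le:
  assumes "0 < h"
  shows "(\<integral>\<^sup>+s\<in>{t-h..t}. f s \<partial>lborel) \<le> ennreal h * left_max f t"
proof (cases "left_max f t")
  case top
  then show ?thesis using assms by (simp add: ennreal_mult_top)
next
  case (real m)
  have le: "(\<integral>\<^sup>+s\<in>{t-h..t}. f s \<partial>lborel) \<le> ennreal (r * m)" if "r \<in> \<rat>" "h < r" for r
  proof -
    have "(\<integral>\<^sup>+s\<in>{t-h..t}. f s \<partial>lborel) \<le> (\<integral>\<^sup>+s\<in>{t-r..t}. f s \<partial>lborel)"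
      by (intro nn_integral_mono mult_left_mono) (use that in \<open>auto simp: indicator_def\<close>)
    also have "\<dots> \<le> ennreal r * left_max f t"
      by (rule left_integral_le_rat) (use that assms in auto)
    finally show ?thesis
      using real that assms by (simp add: ennreal_mult)
  qed
  have "(\<integral>\<^sup>+s\<in>{t-h..t}. f s \<partial>lborel) \<le> ennreal (h * m)"
  proof (rule ccontr)
    assume "\<not> ?thesis"
    obtain r0 where "r0 \<in> \<rat>" "h < r0"
      using Rats_dense_in_real[of h "h + 1"] by auto
    with le obtain x where x: "(\<integral>\<^sup>+s\<in>{t-h..t}. f s \<partial>lborel) = ennreal x" "0 \<le> x"
      by (cases "\<integral>\<^sup>+s\<in>{t-h..t}. f s \<partial>lborel") (force simp: top_unique)+
    have "h * m < x"
      using \<open>\<not> _\<close> x assms real by (simp add: not_le ennreal_less_iff)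
    show False
    proof (cases "m = 0")
      case True
      then show False using le[OF \<open>r0 \<in> \<rat>\<close> \<open>h < r0\<close>] x \<open>h * m < x\<close> by simp
    next
      case False
      then have "0 < m" using real by simp
      then have "h < x / m" using \<open>h * m < x\<close> by (simp add: field_simps)
      then obtain r where r: "r \<in> \<rat>" "h < r" "r < x / m"
        using Rats_dense_in_real by blast
      then have "x \<le> r * m"
        using le[of r] x \<open>0 < m\<close> assms by (simp add: ennreal_le_iff)
      then show False using r \<open>0 < m\<close> by (simp add: field_simps)
    qed
  qed
  then show ?thesis
    using real assms by (simp add: ennreal_mult)
qed

lemma emeasure_UN_le_count_space:
  assumes "countable C" and [measurable]: "\<And>i. i \<in> C \<Longrightarrow> A i \<in> sets M"
  shows "emeasure M (\<Union>i\<in>C. A i) \<le> (\<integral>\<^sup>+i. emeasure M (A i) \<partial>count_space C)"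
proof -
  have [measurable]: "(\<Union>i\<in>C. A i) \<in> sets M"
    using assms by (intro sets.countable_UN') auto
  have "emeasure M (\<Union>i\<in>C. A i) = (\<integral>\<^sup>+x. indicator (\<Union>i\<in>C. A i) x \<partial>M)"
    by simp
  also have "\<dots> \<le> (\<integral>\<^sup>+x. (\<integral>\<^sup>+i. indicator (A i) x \<partial>count_space C) \<partial>M)"
  proof (rule nn_integral_mono)
    fix x
    show "indicator (\<Union>i\<in>C. A i) x \<le> (\<integral>\<^sup>+i. indicator (A i) x \<partial>count_space C :: ennreal)"
    proof (cases "x \<in> (\<Union>i\<in>C. A i)")
      case True
      then obtain i where "i \<in> C" "x \<in> A i" by auto
      then show ?thesis
        using nn_integral_ge_point[of i C "\<lambda>i. indicator (A i) x"] by (auto simp: indicator_def)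
    qed auto
  qed
  also have "\<dots> = (\<integral>\<^sup>+i. (\<integral>\<^sup>+x. indicator (A i) x \<partial>M) \<partial>count_space C)"
    using assms by (intro nn_integral_count_space_nn_integral) auto
  also have "\<dots> = (\<integral>\<^sup>+i. emeasure M (A i) \<partial>count_space C)"
    by (intro nn_integral_cong) simp
  finally show ?thesis .
qed

text \<open>
  The weak type \<open>(1,1)\<close> inequality. Each point \<open>t\<close> of the level set carries an interval
  \<open>[t - r, t]\<close> on which the average of \<open>f\<close> is at least \<open>l\<close>. By Vitali's lemma, countably
  many of the balls of radius \<open>r\<close> about such \<open>t\<close> are disjoint while their 5-fold
  enlargements, of length \<open>10 * r\<close>, cover the level set.
\<close>

lemma left_max_weak_type:
  assumes [measurable]: "f \<in> borel_measurable borel" and "0 < l"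
  shows "ennreal l * emeasure lborel {t. ennreal l < left_max f t} \<le> 10 * (\<integral>\<^sup>+s. f s \<partial>lborel)"
proof (cases "(\<integral>\<^sup>+s. f s \<partial>lborel)")
  case top
  then show ?thesis by (simp add: ennreal_mult_top)
next
  case (real I)
  let ?K = "{t. ennreal l < left_max f t}"
  have "\<exists>h. 0 < h \<and> ennreal (l * h) \<le> (\<integral>\<^sup>+s\<in>{t-h..t}. f s \<partial>lborel)" if "t \<in> ?K" for t
  proof -
    from that obtain h where h: "h \<in> \<rat>" "0 < h"
        "ennreal l < (\<integral>\<^sup>+s\<in>{t-h..t}. f s \<partial>lborel) / ennreal h"
      by (auto simp: left_max_def less_SUP_iff)
    have "ennreal (l * h) = ennreal l * ennreal h"
      using h assms by (simp add: ennreal_mult)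
    also have "\<dots> \<le> (\<integral>\<^sup>+s\<in>{t-h..t}. f s \<partial>lborel) / ennreal h * ennreal h"
      using h by (intro mult_right_mono) auto
    also have "\<dots> = (\<integral>\<^sup>+s\<in>{t-h..t}. f s \<partial>lborel)"
      using h by (simp add: ennreal_divide_times ennreal_mult_divide_eq)
    finally show ?thesis using h by auto
  qed
  then obtain r where r: "\<And>t. t \<in> ?K \<Longrightarrow> 0 < r t"
      "\<And>t. t \<in> ?K \<Longrightarrow> ennreal (l * r t) \<le> (\<integral>\<^sup>+s\<in>{t - r t..t}. f s \<partial>lborel)"
    by metis
  \<comment> \<open>Vitali's lemma needs bounded radii; they are bounded because \<open>f\<close> is integrable.\<close>
  have bound: "r t \<le> I / l" if "t \<in> ?K" for t
  proof -
    have "ennreal (l * r t) \<le> (\<integral>\<^sup>+s. f s \<partial>lborel)"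
      by (rule order_trans[OF r(2)[OF that]]) (intro nn_integral_mono, auto simp: indicator_def)
    then show ?thesis using real assms by (simp add: field_simps)
  qed
  obtain C where C: "countable C" "C \<subseteq> ?K"
      "pairwise (\<lambda>i j. disjnt (cball i (r i)) (cball j (r j))) C"
      "?K \<subseteq> (\<Union>i\<in>C. cball i (5 * r i))"
  proof (rule Vitali_covering_lemma_cballs[where S = ?K and K = ?K and a = "\<lambda>t. t" and r = r and B = "I / l"])
    show "?K \<subseteq> (\<Union>i\<in>?K. cball i (r i))"
      using r(1) by (fastforce intro: less_imp_le)
  qed (use r(1) bound in auto)
  have "emeasure lborel ?K \<le> emeasure lborel (\<Union>i\<in>C. cball i (5 * r i))"
    using C by (intro emeasure_mono sets.countable_UN') auto
  also have "\<dots> \<le> (\<integral>\<^sup>+i. emeasure lborel (cball i (5 * r i)) \<partial>count_space C)"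
    using C by (intro emeasure_UN_le_count_space) auto
  also have "\<dots> = (\<integral>\<^sup>+i. ennreal (10 * r i) \<partial>count_space C)"
    using C r(1) by (intro nn_integral_cong) (auto simp: cball_eq_atLeastAtMost less_imp_le)
  finally have "ennreal l * emeasure lborel ?K \<le> ennreal l * (\<integral>\<^sup>+i. ennreal (10 * r i) \<partial>count_space C)"
    by (intro mult_left_mono) auto
  also have "\<dots> = (\<integral>\<^sup>+i. ennreal l * ennreal (10 * r i) \<partial>count_space C)"
    by (simp add: nn_integral_cmult)
  also have "\<dots> \<le> (\<integral>\<^sup>+i. 10 * emeasure (density lborel f) (cball i (r i)) \<partial>count_space C)"
  proof (intro nn_integral_mono)
    fix i assume "i \<in> space (count_space C)"
    then have i: "i \<in> ?K" using C by auto
    have "ennreal l * ennreal (10 * r i) = 10 * ennreal (l * r i)"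
      using r(1)[OF i] assms by (simp flip: ennreal_mult ennreal_numeral add: mult_ac)
    also have "ennreal (l * r i) \<le> (\<integral>\<^sup>+s\<in>{i - r i..i}. f s \<partial>lborel)"
      using r(2)[OF i] .
    also have "\<dots> \<le> (\<integral>\<^sup>+s\<in>cball i (r i). f s \<partial>lborel)"
      using r(1)[OF i] by (intro nn_integral_mono) (auto simp: cball_eq_atLeastAtMost indicator_def)
    also have "\<dots> = emeasure (density lborel f) (cball i (r i))"
      by (simp add: emeasure_density)
    finally show "ennreal l * ennreal (10 * r i) \<le> 10 * emeasure (density lborel f) (cball i (r i))"
      by (simp add: mult_left_mono)
  qed
  also have "\<dots> = 10 * (\<integral>\<^sup>+i. emeasure (density lborel f) (cball i (r i)) \<partial>count_space C)"
    by (simp add: nn_integral_cmult)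
  also have "(\<integral>\<^sup>+i. emeasure (density lborel f) (cball i (r i)) \<partial>count_space C)
      = emeasure (density lborel f) (\<Union>i\<in>C. cball i (r i))"
    using C by (intro emeasure_UN_countable[symmetric])
      (auto simp: disjoint_family_on_def pairwise_def disjnt_def)
  also have "\<dots> \<le> emeasure (density lborel f) (space (density lborel f))"
    by (intro emeasure_mono) auto
  also have "\<dots> = (\<integral>\<^sup>+s. f s \<partial>lborel)"
    by (simp add: emeasure_density)
  finally show ?thesis
    by (simp add: mult_left_mono)
qed

lemma left_max_le_add:
  assumes [measurable]: "f \<in> borel_measurable borel" "g \<in> borel_measurable borel"
    and le: "\<And>s. f s \<le> g s + c"
  shows "left_max f t \<le> left_max g t + c"
  unfolding left_max_def[of f]
proof (rule SUP_least)
  fix h :: real assume "h \<in> {h \<in> \<rat>. 0 < h}"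
  then have "0 < h" by simp
  have "(\<integral>\<^sup>+s\<in>{t-h..t}. f s \<partial>lborel) \<le> (\<integral>\<^sup>+s\<in>{t-h..t}. (g s + c) \<partial>lborel)"
    by (intro nn_integral_mono mult_right_mono le) auto
  also have "\<dots> = (\<integral>\<^sup>+s\<in>{t-h..t}. g s \<partial>lborel) + ennreal h * c"
    using \<open>0 < h\<close> by (simp add: distrib_right nn_integral_add nn_integral_cmult_indicator mult.commute)
  also have "\<dots> \<le> ennreal h * left_max g t + ennreal h * c"
    by (intro add_right_mono left_integral_le \<open>0 < h\<close>)
  also have "\<dots> = (left_max g t + c) * ennreal h"
    by (simp add: distrib_left mult.commute)
  finally show "(\<integral>\<^sup>+s\<in>{t-h..t}. f s \<partial>lborel) / ennreal h \<le> left_max g t + c"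
    using \<open>0 < h\<close> by (simp add: divide_le_posI_ennreal mult.commute)
qed

section \<open>The maximal inequality\<close>

lemma nn_integral_powr_from_0:
  fixes a c :: real
  assumes "-1 < a" "0 \<le> c"
  shows "(\<integral>\<^sup>+x\<in>{0..c}. ennreal (x powr a) \<partial>lborel) = ennreal (c powr (a + 1) / (a + 1))"
  by (rule nn_integral_has_integral_lebesgue') (use has_integral_powr_from_0[OF assms] in auto)

lemma nn_integral_powr_to_inf:
  fixes a c :: real
  assumes "a < -1" "0 < c"
  shows "(\<integral>\<^sup>+x\<in>{c..}. ennreal (x powr a) \<partial>lborel) = ennreal (c powr (a + 1) / - (a + 1))"
proof -
  have "(\<integral>\<^sup>+x\<in>{c..}. ennreal (x powr a) \<partial>lborel) = ennreal (- (c powr (a + 1)) / (a + 1))"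
    by (rule nn_integral_has_integral_lebesgue') (use has_integral_powr_to_inf[OF assms] in auto)
  then show ?thesis by (simp only: divide_minus_left divide_minus_right)
qed

text \<open>
  The part of \<open>g\<close> below \<open>l / 4\<close> raises the maximal function by at most \<open>l / 4\<close>, hence the
  level set at height \<open>l\<close> is controlled by the part of \<open>g\<close> above \<open>l / 4\<close> alone. The
  real-valued \<open>enn2real (left_max g t)\<close> is \<open>0\<close> where the maximal function is infinite,
  which only shrinks the level set.
\<close>

lemma left_max_truncated_weak_type:
  fixes g :: "real \<Rightarrow> real"
  assumes [measurable]: "g \<in> borel_measurable borel" and "0 < l"
  shows "ennreal l * emeasure lborel {t. l \<le> enn2real (left_max g t)}
    \<le> 40 * (\<integral>\<^sup>+s. ennreal (g s) * indicator {l / 4..} (g s) \<partial>lborel)"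
proof -
  define f1 where "f1 s = ennreal (g s) * indicator {l / 4..} (g s)" for s
  have [measurable]: "f1 \<in> borel_measurable borel"
    unfolding f1_def by measurable
  have "ennreal (l / 4) < left_max f1 t" if "l \<le> enn2real (left_max g t)" for t
  proof (rule ccontr)
    assume "\<not> ?thesis"
    have "left_max g t \<le> left_max f1 t + ennreal (l / 4)"
      by (rule left_max_le_add) (auto simp: f1_def indicator_def ennreal_leI)
    also have "\<dots> \<le> ennreal (l / 4) + ennreal (l / 4)"
      using \<open>\<not> _\<close> by (intro add_right_mono) simp
    also have "\<dots> = ennreal (l / 2)"
      using \<open>0 < l\<close> by (simp flip: ennreal_plus)
    finally have "enn2real (left_max g t) \<le> enn2real (ennreal (l / 2))"
      by (intro enn2real_mono) auto
    with that \<open>0 < l\<close> show False by simp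
  qed
  then have "emeasure lborel {t. l \<le> enn2real (left_max g t)} \<le> emeasure lborel {t. ennreal (l / 4) < left_max f1 t}"
    by (intro emeasure_mono) auto
  moreover have "ennreal l = 4 * ennreal (l / 4)"
    using \<open>0 < l\<close> by (simp flip: ennreal_mult ennreal_numeral)
  ultimately have "ennreal l * emeasure lborel {t. l \<le> enn2real (left_max g t)}
      \<le> 4 * ennreal (l / 4) * emeasure lborel {t. ennreal (l / 4) < left_max f1 t}"
    by (simp add: mult_left_mono)
  also have "\<dots> \<le> 4 * (10 * (\<integral>\<^sup>+s. f1 s \<partial>lborel))"
    unfolding mult.assoc using \<open>0 < l\<close> by (intro mult_left_mono left_max_weak_type) auto
  also have "\<dots> = 40 * (\<integral>\<^sup>+s. f1 s \<partial>lborel)"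
    by (simp flip: mult.assoc)
  finally show ?thesis by (simp add: f1_def)
qed

text \<open>
  The Hardy--Littlewood inequality in \<open>L\<^sub>p\<close>: write \<open>m\<^sup>p\<close> as the integral of \<open>p * l powr (p - 1)\<close>
  over \<open>{0..m}\<close>, exchange the integrals, and insert the truncated weak type inequality.
\<close>

lemma left_max_strong_type:
  fixes g :: "real \<Rightarrow> real" and p :: real
  assumes [measurable]: "g \<in> borel_measurable borel" and nonneg: "\<And>s. 0 \<le> g s" and "1 < p"
  shows "(\<integral>\<^sup>+t. ennreal (enn2real (left_max g t) powr p) \<partial>lborel)
    \<le> ennreal (40 * p * 4 powr (p - 1) / (p - 1)) * (\<integral>\<^sup>+s. ennreal (g s powr p) \<partial>lborel)"
proof -
  define m where "m t = enn2real (left_max g t)" for t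
  have [measurable]: "m \<in> borel_measurable borel"
    unfolding m_def by measurable
  have m_nonneg: "0 \<le> m t" for t by (simp add: m_def)
  have "ennreal (m t powr p) = ennreal p * (\<integral>\<^sup>+l\<in>{0..m t}. ennreal (l powr (p - 1)) \<partial>lborel)" for t
    using nn_integral_powr_from_0[of "p - 1" "m t"] \<open>1 < p\<close> m_nonneg by (simp flip: ennreal_mult)
  then have "(\<integral>\<^sup>+t. ennreal (m t powr p) \<partial>lborel)
      = (\<integral>\<^sup>+t. ennreal p * (\<integral>\<^sup>+l\<in>{0..m t}. ennreal (l powr (p - 1)) \<partial>lborel) \<partial>lborel)"
    by simp
  also have "\<dots> = (\<integral>\<^sup>+t. (\<integral>\<^sup>+l. ennreal (p * l powr (p - 1)) * (if 0 \<le> l \<and> l \<le> m t then 1 else 0) \<partial>lborel) \<partial>lborel)"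
    using \<open>1 < p\<close> by (subst nn_integral_cmult[symmetric])
      (auto simp: ennreal_mult mult.assoc indicator_def intro!: nn_integral_cong)
  also have "\<dots> = (\<integral>\<^sup>+l. (\<integral>\<^sup>+t. ennreal (p * l powr (p - 1)) * (if 0 \<le> l \<and> l \<le> m t then 1 else 0) \<partial>lborel) \<partial>lborel)"
    by (rule lborel_pair.Fubini') measurable
  also have "\<dots> \<le> (\<integral>\<^sup>+l. (\<integral>\<^sup>+s. ennreal (40 * p * l powr (p - 2) * g s) * (if 0 \<le> l \<and> l \<le> 4 * g s then 1 else 0) \<partial>lborel) \<partial>lborel)"
  proof (rule nn_integral_mono)
    fix l :: real
    show "(\<integral>\<^sup>+t. ennreal (p * l powr (p - 1)) * (if 0 \<le> l \<and> l \<le> m t then 1 else 0) \<partial>lborel)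
      \<le> (\<integral>\<^sup>+s. ennreal (40 * p * l powr (p - 2) * g s) * (if 0 \<le> l \<and> l \<le> 4 * g s then 1 else 0) \<partial>lborel)"
    proof (cases "0 < l")
      case False
      then have "l = 0 \<or> \<not> 0 \<le> l" by auto
      then show ?thesis by auto
    next
      case True
      have pow: "l powr (p - 1) = l powr (p - 2) * l"
        using True by (simp add: powr_mult_base powr_add[symmetric] mult.commute)
      have "(\<integral>\<^sup>+t. ennreal (p * l powr (p - 1)) * (if 0 \<le> l \<and> l \<le> m t then 1 else 0) \<partial>lborel)
          = (\<integral>\<^sup>+t. ennreal (p * l powr (p - 1)) * indicator {t. l \<le> m t} t \<partial>lborel)"
        using True by (intro nn_integral_cong) auto
      also have "\<dots> = ennreal (p * l powr (p - 2)) * (ennreal l * emeasure lborel {t. l \<le> m t})"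
        using True \<open>1 < p\<close> by (subst nn_integral_cmult_indicator) (auto simp: pow ennreal_mult mult_ac)
      also have "\<dots> \<le> ennreal (p * l powr (p - 2)) * (40 * (\<integral>\<^sup>+s. ennreal (g s) * indicator {l / 4..} (g s) \<partial>lborel))"
        unfolding m_def by (intro mult_left_mono left_max_truncated_weak_type True) auto
      also have "\<dots> = ennreal (40 * p * l powr (p - 2)) * (\<integral>\<^sup>+s. ennreal (g s) * indicator {l / 4..} (g s) \<partial>lborel)"
        using \<open>1 < p\<close> by (simp add: ennreal_mult mult_ac)
      also have "\<dots> = (\<integral>\<^sup>+s. ennreal (40 * p * l powr (p - 2) * g s) * (if 0 \<le> l \<and> l \<le> 4 * g s then 1 else 0) \<partial>lborel)"
        using \<open>1 < p\<close> True nonneg by (subst nn_integral_cmult[symmetric])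
          (auto simp: ennreal_mult mult.assoc indicator_def intro!: nn_integral_cong)
      finally show ?thesis .
    qed
  qed
  also have "\<dots> = (\<integral>\<^sup>+s. (\<integral>\<^sup>+l. ennreal (40 * p * l powr (p - 2) * g s) * (if 0 \<le> l \<and> l \<le> 4 * g s then 1 else 0) \<partial>lborel) \<partial>lborel)"
    by (rule lborel_pair.Fubini'[symmetric]) measurable
  also have "\<dots> = (\<integral>\<^sup>+s. ennreal (40 * p * 4 powr (p - 1) / (p - 1)) * ennreal (g s powr p) \<partial>lborel)"
  proof (rule nn_integral_cong)
    fix s
    have pow: "g s powr p = g s powr (p - 1) * g s"
      using nonneg[of s] \<open>1 < p\<close> by (cases "g s = 0") (auto simp: powr_mult_base powr_add[symmetric] mult.commute)
    have "(\<integral>\<^sup>+l. ennreal (40 * p * l powr (p - 2) * g s) * (if 0 \<le> l \<and> l \<le> 4 * g s then 1 else 0) \<partial>lborel)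
      = ennreal (40 * p * g s) * (\<integral>\<^sup>+l\<in>{0..4 * g s}. ennreal (l powr (p - 2)) \<partial>lborel)"
      using \<open>1 < p\<close> nonneg by (subst nn_integral_cmult[symmetric])
        (auto simp: ennreal_mult mult_ac indicator_def intro!: nn_integral_cong)
    also have "\<dots> = ennreal (40 * p * g s) * ennreal ((4 * g s) powr (p - 1) / (p - 1))"
      using \<open>1 < p\<close> nonneg[of s] by (subst nn_integral_powr_from_0) auto
    also have "\<dots> = ennreal (40 * p * 4 powr (p - 1) / (p - 1)) * ennreal (g s powr p)"
      using \<open>1 < p\<close> nonneg[of s] by (simp add: pow powr_mult mult_ac flip: ennreal_mult)
    finally show "(\<integral>\<^sup>+l. ennreal (40 * p * l powr (p - 2) * g s) * (if 0 \<le> l \<and> l \<le> 4 * g s then 1 else 0) \<partial>lborel)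
      = ennreal (40 * p * 4 powr (p - 1) / (p - 1)) * ennreal (g s powr p)" .
  qed
  also have "\<dots> = ennreal (40 * p * 4 powr (p - 1) / (p - 1)) * (\<integral>\<^sup>+s. ennreal (g s powr p) \<partial>lborel)"
    by (simp add: nn_integral_cmult)
  finally show ?thesis by (simp add: m_def)
qed

lemma left_max_finite_AE:
  assumes [measurable]: "f \<in> borel_measurable borel" and fin: "(\<integral>\<^sup>+s. f s \<partial>lborel) < \<infinity>"
  shows "AE t in lborel. left_max f t < \<infinity>"
proof -
  obtain I where I: "(\<integral>\<^sup>+s. f s \<partial>lborel) = ennreal I" "0 \<le> I"
    using fin by (cases "(\<integral>\<^sup>+s. f s \<partial>lborel)") auto
  let ?E = "{t. left_max f t = \<infinity>}"
  have [measurable]: "?E \<in> sets lborel" by measurable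
  have le: "ennreal l * emeasure lborel ?E \<le> ennreal (10 * I)" if "0 < l" for l
  proof -
    have "ennreal l * emeasure lborel ?E \<le> ennreal l * emeasure lborel {t. ennreal l < left_max f t}"
      by (intro mult_left_mono emeasure_mono) auto
    also have "\<dots> \<le> ennreal (10 * I)"
      using left_max_weak_type[OF assms(1) that] I by (simp add: ennreal_mult)
    finally show ?thesis .
  qed
  have "emeasure lborel ?E = 0"
  proof (cases "emeasure lborel ?E")
    case top
    then show ?thesis using le[of 1] by (simp add: top_unique)
  next
    case (real e)
    show ?thesis
    proof (rule ccontr)
      assume "\<not> ?thesis"
      then have "0 < e" using real by (auto simp: less_le)
      have "0 < (10 * I + 1) / e" using I \<open>0 < e\<close> by simp
      from le[OF this] show False
        using real \<open>0 < e\<close> I by (simp flip: ennreal_mult)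
    qed
  qed
  then have "?E \<in> null_sets lborel" by auto
  then show ?thesis
    by (rule AE_I') (auto simp: less_top[symmetric])
qed

section \<open>Fractional integrals as superpositions of averages\<close>

text \<open>
  Since \<open>u powr (b - 1)\<close> is \<open>1 - b\<close> times the integral of \<open>h powr (b - 2)\<close> over \<open>{u..}\<close>,
  Tonelli's theorem turns the fractional integral into a superposition of the integrals of
  \<open>f\<close> over the intervals \<open>{t - h..<t}\<close>.
\<close>

lemma kernel_eq_average:
  assumes [measurable]: "f \<in> borel_measurable borel" and b: "0 < b" "b < 1"
  shows "(\<integral>\<^sup>+s\<in>{..<t}. ennreal ((t - s) powr (b - 1)) * f s \<partial>lborel)
    = (\<integral>\<^sup>+h\<in>{0<..}. ennreal ((1 - b) * h powr (b - 2)) * (\<integral>\<^sup>+s\<in>{t-h..<t}. f s \<partial>lborel) \<partial>lborel)"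
proof -
  have "(\<integral>\<^sup>+s\<in>{..<t}. ennreal ((t - s) powr (b - 1)) * f s \<partial>lborel)
      = (\<integral>\<^sup>+s. (\<integral>\<^sup>+h. ennreal ((1 - b) * h powr (b - 2)) * (f s * (if 0 < h \<and> t - h \<le> s \<and> s < t then 1 else 0)) \<partial>lborel) \<partial>lborel)"
  proof (rule nn_integral_cong)
    fix s
    show "ennreal ((t - s) powr (b - 1)) * f s * indicator {..<t} s
      = (\<integral>\<^sup>+h. ennreal ((1 - b) * h powr (b - 2)) * (f s * (if 0 < h \<and> t - h \<le> s \<and> s < t then 1 else 0)) \<partial>lborel)"
    proof (cases "s < t")
      case True
      have "(\<integral>\<^sup>+h. ennreal ((1 - b) * h powr (b - 2)) * (f s * (if 0 < h \<and> t - h \<le> s \<and> s < t then 1 else 0)) \<partial>lborel)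
        = (\<integral>\<^sup>+h. (ennreal (1 - b) * f s) * (ennreal (h powr (b - 2)) * indicator {t - s..} h) \<partial>lborel)"
        using True b by (intro nn_integral_cong) (auto simp: ennreal_mult mult_ac indicator_def)
      also have "\<dots> = ennreal (1 - b) * f s * ennreal ((t - s) powr (b - 1) / (1 - b))"
        using True b by (simp add: nn_integral_cmult nn_integral_powr_to_inf)
      also have "\<dots> = (ennreal (1 - b) * ennreal ((t - s) powr (b - 1) / (1 - b))) * f s"
        by (simp add: mult_ac)
      also have "ennreal (1 - b) * ennreal ((t - s) powr (b - 1) / (1 - b)) = ennreal ((t - s) powr (b - 1))"
        using b by (simp flip: ennreal_mult)
      finally show ?thesis using True by simp
    qed simp
  qed
  also have "\<dots> = (\<integral>\<^sup>+h. (\<integral>\<^sup>+s. ennreal ((1 - b) * h powr (b - 2)) * (f s * (if 0 < h \<and> t - h \<le> s \<and> s < t then 1 else 0)) \<partial>lborel) \<partial>lborel)"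
    by (rule lborel_pair.Fubini') measurable
  also have "\<dots> = (\<integral>\<^sup>+h\<in>{0<..}. ennreal ((1 - b) * h powr (b - 2)) * (\<integral>\<^sup>+s\<in>{t-h..<t}. f s \<partial>lborel) \<partial>lborel)"
    by (subst nn_integral_cmult) (auto simp: indicator_def of_bool_def intro!: nn_integral_cong)
  finally show ?thesis .
qed

text \<open>
  The bound \<open>near\<close> is used for \<open>h \<le> d\<close> and the bound \<open>far\<close> for \<open>h > d\<close>.
\<close>

lemma kernel_bound:
  fixes b c d m A :: real
  assumes [measurable]: "f \<in> borel_measurable borel" and b: "0 < b" "b + c < 1" "0 \<le> c" and d: "0 < d"
    and nonneg: "0 \<le> m" "0 \<le> A"
    and near: "\<And>h. 0 < h \<Longrightarrow> (\<integral>\<^sup>+s\<in>{t-h..t}. f s \<partial>lborel) \<le> ennreal (m * h)"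
    and far: "\<And>h. d \<le> h \<Longrightarrow> (\<integral>\<^sup>+s\<in>{t-h..t}. f s \<partial>lborel) \<le> ennreal (A * h powr c)"
  shows "(\<integral>\<^sup>+s\<in>{..<t}. ennreal ((t - s) powr (b - 1)) * f s \<partial>lborel)
    \<le> ennreal ((1 - b) * (m * (d powr b / b) + A * (d powr (b + c - 1) / (1 - b - c))))"
proof -
  have "b < 1" using b by simp
  have "(\<integral>\<^sup>+s\<in>{..<t}. ennreal ((t - s) powr (b - 1)) * f s \<partial>lborel)
    \<le> (\<integral>\<^sup>+h. ennreal ((1 - b) * m) * (ennreal (h powr (b - 1)) * indicator {0..d} h)
         + ennreal ((1 - b) * A) * (ennreal (h powr (b + c - 2)) * indicator {d..} h) \<partial>lborel)"
    unfolding kernel_eq_average[OF assms(1) \<open>0 < b\<close> \<open>b < 1\<close>]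
  proof (rule nn_integral_mono)
    fix h :: real
    show "ennreal ((1 - b) * h powr (b - 2)) * (\<integral>\<^sup>+s\<in>{t-h..<t}. f s \<partial>lborel) * indicator {0<..} h
      \<le> ennreal ((1 - b) * m) * (ennreal (h powr (b - 1)) * indicator {0..d} h)
         + ennreal ((1 - b) * A) * (ennreal (h powr (b + c - 2)) * indicator {d..} h)"
    proof (cases "0 < h")
      case True
      have pow: "h powr (b - 1) = h powr (b - 2) * h" "h powr (b + c - 2) = h powr (b - 2) * h powr c"
        using True by (simp_all add: powr_mult_base powr_add[symmetric] mult.commute algebra_simps)
      have le: "(\<integral>\<^sup>+s\<in>{t-h..<t}. f s \<partial>lborel) \<le> (\<integral>\<^sup>+s\<in>{t-h..t}. f s \<partial>lborel)"
        by (intro nn_integral_mono) (auto simp: indicator_def)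
      show ?thesis
      proof (cases "h \<le> d")
        case le_d: True
        have "ennreal ((1 - b) * h powr (b - 2)) * (\<integral>\<^sup>+s\<in>{t-h..<t}. f s \<partial>lborel)
          \<le> ennreal ((1 - b) * h powr (b - 2)) * ennreal (m * h)"
          by (intro mult_left_mono order_trans[OF le near] True) simp
        also have "\<dots> = ennreal ((1 - b) * m) * ennreal (h powr (b - 1))"
          using \<open>b < 1\<close> True nonneg by (simp add: pow mult_ac flip: ennreal_mult)
        finally show ?thesis
          using True le_d by (simp add: add_increasing2)
      next
        case False
        have "ennreal ((1 - b) * h powr (b - 2)) * (\<integral>\<^sup>+s\<in>{t-h..<t}. f s \<partial>lborel)
          \<le> ennreal ((1 - b) * h powr (b - 2)) * ennreal (A * h powr c)"
          by (intro mult_left_mono order_trans[OF le far]) (use False in auto)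
        also have "\<dots> = ennreal ((1 - b) * A) * ennreal (h powr (b + c - 2))"
          using \<open>b < 1\<close> True nonneg by (simp add: pow mult_ac flip: ennreal_mult)
        finally show ?thesis
          using True False by simp
      qed
    qed simp
  qed
  also have "\<dots> = ennreal ((1 - b) * m) * ennreal (d powr b / b)
       + ennreal ((1 - b) * A) * ennreal (d powr (b + c - 1) / (1 - b - c))"
  proof -
    have "(\<integral>\<^sup>+h\<in>{0..d}. ennreal (h powr (b - 1)) \<partial>lborel) = ennreal (d powr b / b)"
      using b d by (subst nn_integral_powr_from_0) auto
    moreover have "(\<integral>\<^sup>+h\<in>{d..}. ennreal (h powr (b + c - 2)) \<partial>lborel) = ennreal (d powr (b + c - 1) / (1 - b - c))"
      using b d by (subst nn_integral_powr_to_inf) (auto simp: algebra_simps)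
    ultimately show ?thesis
      by (simp add: nn_integral_add nn_integral_cmult)
  qed
  also have "\<dots> = ennreal ((1 - b) * (m * (d powr b / b) + A * (d powr (b + c - 1) / (1 - b - c))))"
    using b \<open>b < 1\<close> nonneg by (simp add: distrib_left mult.assoc flip: ennreal_mult ennreal_plus)
  finally show ?thesis .
qed

section \<open>Lower bounds for the Gamma function\<close>

lemma Gamma_real_bounded_below:
  obtains c :: real where "0 < c" and "\<And>x. 1 \<le> x \<Longrightarrow> c \<le> Gamma x"
proof -
  have "continuous_on {1..2::real} Gamma"
    by (intro continuous_on_Gamma) (auto elim!: nonpos_Ints_cases)
  then obtain x0 :: real where x0: "x0 \<in> {1..2}" "\<And>x. x \<in> {1..2} \<Longrightarrow> Gamma x0 \<le> Gamma x"
    using continuous_attains_inf[of "{1..2::real}" Gamma] by auto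
  have "Gamma x0 \<le> Gamma x" if "1 \<le> x" "x \<le> real n + 2" for n x
    using that
  proof (induction n arbitrary: x)
    case 0
    then show ?case using x0 by simp
  next
    case (Suc n)
    show ?case
    proof (cases "x \<le> 2")
      case True
      then show ?thesis using x0 Suc by simp
    next
      case False
      have "x - 1 \<notin> \<int>\<^sub>\<le>\<^sub>0"
        using False by (auto elim!: nonpos_Ints_cases)
      from Gamma_plus1[OF this] have "Gamma x = (x - 1) * Gamma (x - 1)"
        by simp
      moreover have "1 * Gamma (x - 1) \<le> (x - 1) * Gamma (x - 1)"
        using False by (intro mult_right_mono) (auto intro: less_imp_le Gamma_real_pos)
      moreover have "Gamma x0 \<le> Gamma (x - 1)"
        using False Suc by (intro Suc.IH) auto
      ultimately show ?thesis by simp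
    qed
  qed
  moreover have "x \<le> real (nat \<lceil>x\<rceil>) + 2" for x :: real
    by linarith
  ultimately have "Gamma x0 \<le> Gamma x" if "1 \<le> x" for x
    using that by blast
  moreover have "0 < Gamma x0"
    using x0 by (intro Gamma_real_pos) auto
  ultimately show ?thesis using that by blast
qed

text \<open>
  This makes the estimates uniform as the order tends to \<open>0\<close>: the factor \<open>1 / Gamma a\<close>
  compensates the factor \<open>1 / a\<close> coming from the kernel. The reason is
  \<open>a * Gamma a = Gamma (a + 1)\<close>.
\<close>

lemma Gamma_real_ge_inverse:
  obtains c :: real where "0 < c" and "\<And>a. 0 < a \<Longrightarrow> c * max 1 (1 / a) \<le> Gamma a"
proof -
  obtain c :: real where c: "0 < c" "\<And>x. 1 \<le> x \<Longrightarrow> c \<le> Gamma x"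
    using Gamma_real_bounded_below by blast
  have "c * max 1 (1 / a) \<le> Gamma a" if "0 < a" for a
  proof (cases "1 \<le> a")
    case True
    then show ?thesis using c by (simp add: max_absorb1)
  next
    case False
    have "a \<notin> \<int>\<^sub>\<le>\<^sub>0"
      using that by (auto elim!: nonpos_Ints_cases)
    then have "Gamma (a + 1) = a * Gamma a"
      by (rule Gamma_plus1)
    with c(2)[of "a + 1"] that have "c \<le> a * Gamma a"
      by simp
    then show ?thesis using that False by (simp add: max_def field_simps)
  qed
  with c show ?thesis using that by blast
qed

section \<open>Interpolation between powers\<close>

text \<open>
  The integrated form of this pointwise inequality replaces the Hoelder inequality below, at the
  price of a constant: \<open>c\<close> is chosen afterwards to balance the two terms.
\<close>

lemma powr_le_powr_add:
  fixes x c q r :: real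
  assumes "0 \<le> x" "0 < c" "0 < q" "q \<le> r"
  shows "x powr q \<le> c powr (q - r) * x powr r + c powr q"
proof (cases "x \<le> c")
  case True
  then have "x powr q \<le> c powr q" using assms by (intro powr_mono2) auto
  then show ?thesis by (simp add: add_increasing)
next
  case False
  have "x powr q = x powr (q - r) * x powr r"
    using False assms by (simp flip: powr_add)
  also have "x powr (q - r) \<le> c powr (q - r)"
    using False assms by (intro powr_mono2') auto
  finally show ?thesis by (simp add: add_increasing2 mult_right_mono)
qed

lemma nn_integral_powr_le:
  fixes g :: "'a \<Rightarrow> real" and c q r :: real
  assumes [measurable]: "g \<in> borel_measurable M" "A \<in> sets M" and "\<And>x. 0 \<le> g x"
    and "0 < c" "0 < q" "q \<le> r"
  shows "(\<integral>\<^sup>+x\<in>A. ennreal (g x powr q) \<partial>M)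
    \<le> ennreal (c powr (q - r)) * (\<integral>\<^sup>+x. ennreal (g x powr r) \<partial>M) + ennreal (c powr q) * emeasure M A"
proof -
  have "(\<integral>\<^sup>+x\<in>A. ennreal (g x powr q) \<partial>M)
    \<le> (\<integral>\<^sup>+x. ennreal (c powr (q - r)) * ennreal (g x powr r) + ennreal (c powr q) * indicator A x \<partial>M)"
  proof (rule nn_integral_mono)
    fix x
    have "ennreal (g x powr q) \<le> ennreal (c powr (q - r)) * ennreal (g x powr r) + ennreal (c powr q)"
      using powr_le_powr_add[of "g x" c q r] assms by (simp add: ennreal_leI flip: ennreal_mult ennreal_plus)
    then show "ennreal (g x powr q) * indicator A x
      \<le> ennreal (c powr (q - r)) * ennreal (g x powr r) + ennreal (c powr q) * indicator A x"
      by (auto simp: indicator_def)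
  qed
  also have "\<dots> = ennreal (c powr (q - r)) * (\<integral>\<^sup>+x. ennreal (g x powr r) \<partial>M) + ennreal (c powr q) * emeasure M A"
    by (simp add: nn_integral_add nn_integral_cmult)
  finally show ?thesis .
qed

section \<open>Pointwise estimates by the maximal function\<close>

text \<open>
  The Riemann--Liouville integral of constant order \<open>a\<close> at the point \<open>t\<close>, without the factor
  \<open>1 / Gamma a\<close>, of a nonnegative function on the line; in the applications \<open>g\<close> vanishes outside
  \<open>{0..1}\<close>. As a Lebesgue integral of a nonnegative function it always exists in \<open>[0, \<infinity>]\<close>.
\<close>

definition RL_nn :: "real \<Rightarrow> (real \<Rightarrow> real) \<Rightarrow> real \<Rightarrow> ennreal" where
  "RL_nn a g t = (\<integral>\<^sup>+s\<in>{..<t}. ennreal ((t - s) powr (a - 1)) * ennreal (g s) \<partial>lborel)"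

lemma RL_nn_mono_order:
  assumes supp: "\<And>s. s \<notin> {0..1} \<Longrightarrow> g s = 0" and "t \<le> 1" and "b \<le> a"
  shows "RL_nn a g t \<le> RL_nn b g t"
  unfolding RL_nn_def
proof (rule nn_integral_mono)
  fix s
  show "ennreal ((t - s) powr (a - 1)) * ennreal (g s) * indicator {..<t} s
      \<le> ennreal ((t - s) powr (b - 1)) * ennreal (g s) * indicator {..<t} s"
  proof (cases "s \<in> {0..1} \<and> s < t")
    case True
    then have "(t - s) powr (a - 1) \<le> (t - s) powr (b - 1)"
      using assms by (intro powr_mono') auto
    then show ?thesis by (intro mult_right_mono ennreal_leI) auto
  next
    case False
    then show ?thesis using supp[of s] by auto
  qed
qed

text \<open>
  The estimate for \<open>q \<le> p\<close>. For \<open>a < 1\<close> the integrals over \<open>{t - h..t}\<close> are at most \<open>m * h\<close>, and also at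
  most \<open>m\<close> because \<open>g\<close> lives on an interval of length \<open>1\<close>; hence the splitting at \<open>d = 1\<close>.
\<close>

lemma RL_nn_le_left_max:
  fixes g :: "real \<Rightarrow> real"
  assumes [measurable]: "g \<in> borel_measurable borel"
    and supp: "\<And>s. s \<notin> {0..1} \<Longrightarrow> g s = 0" and "t \<le> 1" and "0 < a"
    and m: "left_max g t = ennreal m" "0 \<le> m"
  shows "RL_nn a g t \<le> ennreal (max 1 (1 / a) * m)"
proof -
  have avg: "(\<integral>\<^sup>+s\<in>{t-h..t}. g s \<partial>lborel) \<le> ennreal (m * h)" if "0 < h" for h
    using left_integral_le[OF that, of "\<lambda>s. ennreal (g s)" t] m that
    by (simp add: ennreal_mult mult.commute)
  have unit: "(\<integral>\<^sup>+s\<in>{..t}. g s \<partial>lborel) \<le> ennreal m"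
  proof -
    have "(\<integral>\<^sup>+s\<in>{..t}. g s \<partial>lborel) \<le> (\<integral>\<^sup>+s\<in>{t-1..t}. g s \<partial>lborel)"
    proof (rule nn_integral_mono)
      fix s show "ennreal (g s) * indicator {..t} s \<le> ennreal (g s) * indicator {t-1..t} s"
        using supp[of s] \<open>t \<le> 1\<close> by (cases "s \<in> {0..1}") (auto simp: indicator_def)
    qed
    with avg[of 1] show ?thesis by simp
  qed
  show ?thesis
  proof (cases "1 \<le> a")
    case True
    have "RL_nn a g t \<le> RL_nn 1 g t"
      using assms True by (intro RL_nn_mono_order) auto
    also have "\<dots> \<le> (\<integral>\<^sup>+s\<in>{..t}. g s \<partial>lborel)"
      unfolding RL_nn_def by (intro nn_integral_mono) (auto simp: indicator_def)
    also have "\<dots> \<le> ennreal m" by (rule unit)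
    also have "m = max 1 (1 / a) * m"
      using True by (simp add: max_absorb1)
    finally show ?thesis .
  next
    case False
    have "RL_nn a g t \<le> ennreal ((1 - a) * (m * (1 powr a / a) + m * (1 powr (a + 0 - 1) / (1 - a - 0))))"
      unfolding RL_nn_def
    proof (rule kernel_bound)
      fix h :: real assume "1 \<le> h"
      have "(\<integral>\<^sup>+s\<in>{t-h..t}. g s \<partial>lborel) \<le> (\<integral>\<^sup>+s\<in>{..t}. g s \<partial>lborel)"
        by (intro nn_integral_mono) (auto simp: indicator_def)
      with unit \<open>1 \<le> h\<close> show "(\<integral>\<^sup>+s\<in>{t-h..t}. g s \<partial>lborel) \<le> ennreal (m * h powr 0)"
        by simp
    qed (use False assms avg in auto)
    also have "(1 - a) * (m * (1 powr a / a) + m * (1 powr (a + 0 - 1) / (1 - a - 0))) = max 1 (1 / a) * m"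
      using False \<open>0 < a\<close> by (simp add: max_def field_simps)
    finally show ?thesis .
  qed
qed

lemma left_integral_le_powr:
  fixes g :: "real \<Rightarrow> real"
  assumes [measurable]: "g \<in> borel_measurable borel" and nonneg: "\<And>s. 0 \<le> g s"
    and "1 < p" "0 < N" "0 < h"
    and N: "(\<integral>\<^sup>+s. ennreal (g s powr p) \<partial>lborel) \<le> ennreal (N powr p)"
  shows "(\<integral>\<^sup>+s\<in>{t-h..t}. g s \<partial>lborel) \<le> ennreal (2 * N * h powr (1 - 1 / p))"
proof -
  \<comment> \<open>With the integral of \<open>g powr p\<close> replaced by \<open>N powr p\<close>, this makes both terms of
     \<open>nn_integral_powr_le\<close> equal to \<open>N * h powr (1 - 1 / p)\<close>.\<close>
  define c where "c = N * h powr (- (1 / p))"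
  have "0 < c" using assms by (simp add: c_def)
  have "(\<integral>\<^sup>+s\<in>{t-h..t}. g s \<partial>lborel) = (\<integral>\<^sup>+s\<in>{t-h..t}. ennreal (g s powr 1) \<partial>lborel)"
    using nonneg by simp
  also have "\<dots> \<le> ennreal (c powr (1 - p)) * (\<integral>\<^sup>+s. ennreal (g s powr p) \<partial>lborel)
      + ennreal (c powr 1) * emeasure lborel {t-h..t}"
    by (rule nn_integral_powr_le) (use assms \<open>0 < c\<close> in auto)
  also have "\<dots> \<le> ennreal (c powr (1 - p)) * ennreal (N powr p) + ennreal c * ennreal h"
    using N \<open>0 < c\<close> \<open>0 < h\<close> by (intro add_mono mult_left_mono) auto
  also have "\<dots> = ennreal (c powr (1 - p) * N powr p + c * h)"
    using \<open>0 < c\<close> \<open>0 < h\<close> by (simp add: ennreal_mult)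
  also have "c powr (1 - p) * N powr p = N * h powr (1 - 1 / p)"
  proof -
    have "c powr (1 - p) * N powr p = (N powr (1 - p) * N powr p) * h powr (- (1 / p) * (1 - p))"
      using assms by (simp add: c_def powr_mult powr_powr)
    also have "N powr (1 - p) * N powr p = N"
      using assms by (simp flip: powr_add)
    also have "- (1 / p) * (1 - p) = 1 - 1 / p"
      using assms by (simp add: field_simps)
    finally show ?thesis .
  qed
  also have "c * h = N * h powr (1 - 1 / p)"
    using powr_mult_base[of h "- (1 / p)"] \<open>0 < h\<close> by (simp add: c_def mult_ac)
  finally show ?thesis by (simp add: algebra_simps)
qed

text \<open>
  Hedberg's inequality, which gives the estimate for \<open>p < q\<close> at the critical order: short intervals
  are estimated by the maximal function, long ones by the \<open>L\<^sub>p\<close> norm.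
\<close>

lemma RL_nn_hedberg:
  fixes g :: "real \<Rightarrow> real" and p q :: real
  assumes [measurable]: "g \<in> borel_measurable borel" and nonneg: "\<And>s. 0 \<le> g s"
    and pq: "1 < p" "p < q" and "0 < N"
    and N: "(\<integral>\<^sup>+s. ennreal (g s powr p) \<partial>lborel) \<le> ennreal (N powr p)"
    and b: "b = 1 / p - 1 / q"
    and m: "left_max g t = ennreal m" "0 \<le> m"
  shows "RL_nn b g t \<le> ennreal ((1 - b) * (1 / b + 2 * q) * N powr (1 - p / q) * m powr (p / q))"
proof -
  have avg: "(\<integral>\<^sup>+s\<in>{t-h..t}. g s \<partial>lborel) \<le> ennreal (m * h)" if "0 < h" for h
    using left_integral_le[OF that, of "\<lambda>s. ennreal (g s)" t] m that
    by (simp add: ennreal_mult mult.commute)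
  have b_pos: "0 < b" and bc: "b + (1 - 1 / p) < 1" and c: "0 \<le> 1 - 1 / p"
    using pq by (auto simp: b field_simps)
  show ?thesis
  proof (cases "m = 0")
    case True
    \<comment> \<open>Here \<open>g\<close> has integral \<open>0\<close> over every interval \<open>{t - h..t}\<close>, so \<open>A = 0\<close> is admissible.\<close>
    have "RL_nn b g t \<le> ennreal ((1 - b) * (0 * (1 powr b / b) + 0 * (1 powr (b + (1 - 1 / p) - 1) / (1 - b - (1 - 1 / p)))))"
      unfolding RL_nn_def by (rule kernel_bound) (use b_pos bc c avg True in auto)
    then show ?thesis by simp
  next
    case False
    then have "0 < m" using m by simp
    \<comment> \<open>The length at which the two estimates balance.\<close>
    define d where "d = (N / m) powr p"
    have "0 < d" using \<open>0 < m\<close> \<open>0 < N\<close> by (simp add: d_def)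
    have "RL_nn b g t \<le> ennreal ((1 - b) * (m * (d powr b / b) + 2 * N * (d powr (b + (1 - 1 / p) - 1) / (1 - b - (1 - 1 / p)))))"
      unfolding RL_nn_def
    proof (rule kernel_bound)
      fix h assume "d \<le> h"
      then show "(\<integral>\<^sup>+s\<in>{t-h..t}. g s \<partial>lborel) \<le> ennreal (2 * N * h powr (1 - 1 / p))"
        using assms \<open>0 < d\<close> by (intro left_integral_le_powr) auto
    qed (use b_pos bc c avg \<open>0 < d\<close> \<open>0 < N\<close> m in auto)
    also have "b + (1 - 1 / p) - 1 = - (1 / q)"
      by (simp add: b)
    also have "1 - b - (1 - 1 / p) = 1 / q"
      by (simp add: b)
    also have "m * (d powr b / b) = (1 / b) * (N powr (1 - p / q) * m powr (p / q))"
    proof -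
      have "d powr b = (N / m) powr (1 - p / q)"
        using pq by (simp add: d_def powr_powr b right_diff_distrib)
      then have "m * d powr b = N powr (1 - p / q) * m powr (p / q)"
        using \<open>0 < m\<close> \<open>0 < N\<close> by (simp add: powr_divide powr_diff field_simps)
      then show ?thesis by simp
    qed
    also have "2 * N * (d powr (- (1 / q)) / (1 / q)) = 2 * q * (N powr (1 - p / q) * m powr (p / q))"
    proof -
      have "d powr (- (1 / q)) = (N / m) powr (- (p / q))"
        by (simp add: d_def powr_powr)
      then have "N * d powr (- (1 / q)) = N powr (1 - p / q) * m powr (p / q)"
        using \<open>0 < m\<close> \<open>0 < N\<close> by (simp add: powr_divide powr_diff powr_minus)
      moreover have "2 * N * (d powr (- (1 / q)) / (1 / q)) = 2 * q * (N * d powr (- (1 / q)))"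
        by simp
      ultimately show ?thesis by simp
    qed
    finally show ?thesis by (simp add: algebra_simps)
  qed
qed

text \<open>
  The majorant \<open>m\<close> does not depend on the order \<open>a\<close>, so \<open>a\<close> may afterwards be replaced by \<open>\<alpha> t\<close>. It is a
  multiple of the maximal function \<open>M\<close> if \<open>q \<le> p\<close>, and of \<open>M powr (p / q)\<close> if \<open>p < q\<close>. No
  supremum over \<open>a\<close> is needed: for \<open>p < q\<close> the kernel of order \<open>a\<close> is dominated on \<open>{0..1}\<close>
  by the kernel of the critical order \<open>1 / p - 1 / q\<close>, which is positive.
\<close>

lemma RL_nn_majorant:
  fixes p q :: real
  assumes "1 < p" "1 \<le> q"
  obtains K where "0 \<le> K"
    and "\<And>g N. \<lbrakk>g \<in> borel_measurable borel; \<And>s. 0 \<le> g s; \<And>s. s \<notin> {0..1} \<Longrightarrow> g s = 0; 0 < N;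
        (\<integral>\<^sup>+s. ennreal (g s powr p) \<partial>lborel) \<le> ennreal (N powr p)\<rbrakk>
      \<Longrightarrow> \<exists>m\<in>borel_measurable borel. (\<forall>t. 0 \<le> m t) \<and>
          (\<integral>\<^sup>+t\<in>{0..1}. ennreal (m t powr q) \<partial>lborel) \<le> ennreal (K * N powr q) \<and>
          (AE t in lborel. t \<le> 1 \<longrightarrow>
            (\<forall>a>0. 1 / p - 1 / q < a \<longrightarrow> RL_nn a g t \<le> ennreal (Gamma a * m t)))"
proof -
  obtain c :: real where c: "0 < c" "\<And>a. 0 < a \<Longrightarrow> c * max 1 (1 / a) \<le> Gamma a"
    using Gamma_real_ge_inverse by blast
  then have Gamma_ge: "max 1 (1 / a) \<le> Gamma a / c" if "0 < a" for a
    using c(2)[OF that] c(1) by (simp only: pos_le_divide_eq mult.commute)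
  define C where "C = 40 * p * 4 powr (p - 1) / (p - 1)"
  have "0 \<le> C" using assms by (simp add: C_def)
  define b where "b = 1 / p - 1 / q"
  define L where "L = (if q \<le> p then 1 else (1 - b) * (1 / b + 2 * q)) / c"
  have "0 \<le> L"
  proof (cases "q \<le> p")
    case True
    then show ?thesis using c by (simp add: L_def)
  next
    case False
    have "1 / q < 1 / p" "1 / p < 1" "0 < 1 / q"
      using False assms by (auto simp: field_simps)
    then have "0 < b" "b < 1"
      unfolding b_def by linarith+
    then show ?thesis
      using False c assms by (simp add: L_def)
  qed
  define K where "K = L powr q * (C + 1)"
  show thesis
  proof (rule that[of K])
    show "0 \<le> K" using \<open>0 \<le> C\<close> by (simp add: K_def)
  next
    fix g :: "real \<Rightarrow> real" and N :: real
    assume [measurable]: "g \<in> borel_measurable borel" and nonneg: "\<And>s. 0 \<le> g s"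
      and supp: "\<And>s. s \<notin> {0..1} \<Longrightarrow> g s = 0" and "0 < N"
      and N: "(\<integral>\<^sup>+s. ennreal (g s powr p) \<partial>lborel) \<le> ennreal (N powr p)"
    define M where "M t = enn2real (left_max g t)" for t
    have [measurable]: "M \<in> borel_measurable borel"
      unfolding M_def by measurable
    have M_nonneg: "0 \<le> M t" for t by (simp add: M_def)
    have "(\<integral>\<^sup>+t. ennreal (M t powr p) \<partial>lborel) \<le> ennreal C * (\<integral>\<^sup>+s. ennreal (g s powr p) \<partial>lborel)"
      unfolding M_def C_def by (rule left_max_strong_type) (use nonneg assms in auto)
    also have "\<dots> \<le> ennreal C * ennreal (N powr p)"
      by (intro mult_left_mono N) simp
    finally have M_p: "(\<integral>\<^sup>+t. ennreal (M t powr p) \<partial>lborel) \<le> ennreal (C * N powr p)"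
      using \<open>0 \<le> C\<close> by (simp add: ennreal_mult)
    have "(\<integral>\<^sup>+s. ennreal (g s) \<partial>lborel) = (\<integral>\<^sup>+s\<in>{0..1}. ennreal (g s powr 1) \<partial>lborel)"
      using supp nonneg by (intro nn_integral_cong) (auto simp: indicator_def)
    also have "\<dots> \<le> ennreal (1 powr (1 - p)) * (\<integral>\<^sup>+s. ennreal (g s powr p) \<partial>lborel)
        + ennreal (1 powr 1) * emeasure lborel {0..1::real}"
      by (rule nn_integral_powr_le) (use assms nonneg in auto)
    also have "\<dots> \<le> ennreal (N powr p) + 1"
      using N by simp
    also have "\<dots> < \<infinity>"
      by simp
    finally have "AE t in lborel. left_max g t < \<infinity>"
      by (intro left_max_finite_AE) auto
    then have M_eq: "AE t in lborel. left_max g t = ennreal (M t)"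
      by eventually_elim (simp add: M_def)
    show "\<exists>m\<in>borel_measurable borel. (\<forall>t. 0 \<le> m t) \<and>
          (\<integral>\<^sup>+t\<in>{0..1}. ennreal (m t powr q) \<partial>lborel) \<le> ennreal (K * N powr q) \<and>
          (AE t in lborel. t \<le> 1 \<longrightarrow>
            (\<forall>a>0. 1 / p - 1 / q < a \<longrightarrow> RL_nn a g t \<le> ennreal (Gamma a * m t)))"
    proof (cases "q \<le> p")
      case True
      show ?thesis
      proof (intro bexI conjI allI)
        show "(\<lambda>t. L * M t) \<in> borel_measurable borel" by measurable
        show "0 \<le> L * M t" for t using \<open>0 \<le> L\<close> M_nonneg by simp
        have "(\<integral>\<^sup>+t\<in>{0..1}. ennreal ((L * M t) powr q) \<partial>lborel)
            = (\<integral>\<^sup>+t. ennreal (L powr q) * (ennreal (M t powr q) * indicator {0..1} t) \<partial>lborel)"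
          using \<open>0 \<le> L\<close> M_nonneg by (intro nn_integral_cong) (simp add: powr_mult ennreal_mult mult_ac)
        also have "\<dots> = ennreal (L powr q) * (\<integral>\<^sup>+t\<in>{0..1}. ennreal (M t powr q) \<partial>lborel)"
          by (rule nn_integral_cmult) measurable
        also have "\<dots> \<le> ennreal (L powr q) * (ennreal (N powr (q - p)) * (\<integral>\<^sup>+t. ennreal (M t powr p) \<partial>lborel)
            + ennreal (N powr q) * emeasure lborel {0..1::real})"
          by (intro mult_left_mono nn_integral_powr_le) (use assms True M_nonneg \<open>0 < N\<close> in auto)
        also have "\<dots> \<le> ennreal (L powr q) * (ennreal (N powr (q - p)) * ennreal (C * N powr p) + ennreal (N powr q))"
          using M_p by (intro mult_left_mono add_mono) auto
        also have "\<dots> = ennreal (L powr q * (N powr (q - p) * (C * N powr p) + N powr q))"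
          using \<open>0 \<le> C\<close> by (simp add: ennreal_mult)
        also have "L powr q * (N powr (q - p) * (C * N powr p) + N powr q) = K * N powr q"
          using \<open>0 < N\<close> by (simp add: K_def powr_diff field_simps)
        finally show "(\<integral>\<^sup>+t\<in>{0..1}. ennreal ((L * M t) powr q) \<partial>lborel) \<le> ennreal (K * N powr q)" .
        show "AE t in lborel. t \<le> 1 \<longrightarrow>
            (\<forall>a>0. 1 / p - 1 / q < a \<longrightarrow> RL_nn a g t \<le> ennreal (Gamma a * (L * M t)))"
          using M_eq
        proof eventually_elim
          case (elim t)
          show ?case
          proof (intro impI allI)
            fix a :: real assume "t \<le> 1" "0 < a"
            have "RL_nn a g t \<le> ennreal (max 1 (1 / a) * M t)"
              by (rule RL_nn_le_left_max) (use elim M_nonneg supp \<open>t \<le> 1\<close> \<open>0 < a\<close> in auto)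
            also have "\<dots> \<le> ennreal (Gamma a / c * M t)"
              by (intro ennreal_leI mult_right_mono Gamma_ge \<open>0 < a\<close> M_nonneg)
            also have "Gamma a / c * M t = Gamma a * (L * M t)"
              using True by (simp add: L_def)
            finally show "RL_nn a g t \<le> ennreal (Gamma a * (L * M t))" .
          qed
        qed
      qed
    next
      case False
      define m where "m t = L * (N powr (1 - p / q) * M t powr (p / q))" for t
      show ?thesis
      proof (intro bexI conjI allI)
        show "m \<in> borel_measurable borel" unfolding m_def by measurable
        show m_nonneg: "0 \<le> m t" for t using \<open>0 \<le> L\<close> M_nonneg by (simp add: m_def)
        have "m t powr q = L powr q * N powr (q - p) * M t powr p" for t
          using \<open>0 \<le> L\<close> \<open>0 < N\<close> M_nonneg assms
          by (simp add: m_def powr_mult powr_powr left_diff_distrib)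
        then have "(\<integral>\<^sup>+t\<in>{0..1}. ennreal (m t powr q) \<partial>lborel)
            \<le> (\<integral>\<^sup>+t. ennreal (L powr q * N powr (q - p)) * ennreal (M t powr p) \<partial>lborel)"
          by (intro nn_integral_mono) (auto simp: indicator_def ennreal_mult)
        also have "\<dots> = ennreal (L powr q * N powr (q - p)) * (\<integral>\<^sup>+t. ennreal (M t powr p) \<partial>lborel)"
          by (rule nn_integral_cmult) measurable
        also have "\<dots> \<le> ennreal (L powr q * N powr (q - p)) * ennreal (C * N powr p)"
          by (intro mult_left_mono M_p) simp
        also have "\<dots> = ennreal (L powr q * C * N powr q)"
          using \<open>0 < N\<close> \<open>0 \<le> C\<close> by (simp add: powr_diff flip: ennreal_mult)
        also have "\<dots> \<le> ennreal (K * N powr q)"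
          by (intro ennreal_leI mult_right_mono) (auto simp: K_def mult_left_mono)
        finally show "(\<integral>\<^sup>+t\<in>{0..1}. ennreal (m t powr q) \<partial>lborel) \<le> ennreal (K * N powr q)" .
        show "AE t in lborel. t \<le> 1 \<longrightarrow>
            (\<forall>a>0. 1 / p - 1 / q < a \<longrightarrow> RL_nn a g t \<le> ennreal (Gamma a * m t))"
          using M_eq
        proof eventually_elim
          case (elim t)
          show ?case
          proof (intro impI allI)
            fix a :: real assume a: "t \<le> 1" "0 < a" "1 / p - 1 / q < a"
            have "RL_nn a g t \<le> RL_nn b g t"
              using a supp by (intro RL_nn_mono_order) (auto simp: b_def)
            also have "\<dots> \<le> ennreal ((1 - b) * (1 / b + 2 * q) * N powr (1 - p / q) * M t powr (p / q))"
              by (rule RL_nn_hedberg) (use elim M_nonneg nonneg N \<open>0 < N\<close> assms False b_def in auto)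
            also have "(1 - b) * (1 / b + 2 * q) * N powr (1 - p / q) * M t powr (p / q) = c * m t"
              using False c by (simp add: m_def L_def)
            also have "c * m t \<le> Gamma a * m t"
              using Gamma_ge[OF \<open>0 < a\<close>] c by (intro mult_right_mono m_nonneg) (auto simp: field_simps)
            finally show "RL_nn a g t \<le> ennreal (Gamma a * m t)"
              by (auto intro: ennreal_leI)
          qed
        qed
      qed
    qed
  qed
qed

section \<open>The operator of variable order\<close>

lemma AE_lebesgue_on_Icc_iff:
  fixes a b :: real
  shows "(AE t in lebesgue_on {a..b}. P t) \<longleftrightarrow> (AE t in lborel. t \<in> {a..b} \<longrightarrow> P t)"
  by (subst AE_restrict_space_iff) (auto simp: AE_completion_iff)

lemma nn_integral_lebesgue_on_Icc:
  fixes a b :: real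
  shows "nn_integral (lebesgue_on {a..b}) h = (\<integral>\<^sup>+t\<in>{a..b}. h t \<partial>lborel)"
  by (subst nn_integral_restrict_space) (auto simp: nn_integral_completion)

lemma borel_representative:
  fixes f :: "real \<Rightarrow> real"
  assumes "f \<in> borel_measurable (lebesgue_on {a..b})"
  obtains g where "g \<in> borel_measurable borel" "\<And>s. s \<notin> {a..b} \<Longrightarrow> g s = 0"
    "AE s in lborel. s \<in> {a..b} \<longrightarrow> f s = g s"
proof -
  have "(\<lambda>s. if s \<in> {a..b} then f s else 0) \<in> borel_measurable lebesgue"
    using assms by (subst borel_measurable_if) auto
  then obtain h where h: "h \<in> borel_measurable lborel"
      "AE s in lborel. (if s \<in> {a..b} then f s else 0) = h s"
    using completion_ex_borel_measurable_real by blast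
  show thesis
  proof (rule that[of "\<lambda>s. if s \<in> {a..b} then h s else 0"])
    have [measurable]: "h \<in> borel_measurable borel" using h(1) by simp
    show "(\<lambda>s. if s \<in> {a..b} then h s else 0) \<in> borel_measurable borel"
      by measurable
    show "AE s in lborel. s \<in> {a..b} \<longrightarrow> f s = (if s \<in> {a..b} then h s else 0)"
      using h(2) by eventually_elim auto
  qed auto
qed

lemma RL_integrand_measurable:
  assumes "f \<in> borel_measurable (lebesgue_on {0..1})" "t \<le> 1"
  shows "RL_integrand \<alpha> f t \<in> borel_measurable (lebesgue_on {0..t})"
proof -
  have [measurable]: "f \<in> borel_measurable (lebesgue_on {0..t})"
    by (rule measurable_restrict_mono[OF assms(1)]) (use assms in auto)
  have "(\<lambda>s. (t - s) powr (\<alpha> t - 1)) \<in> borel_measurable lborel"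
    by simp
  then have [measurable]: "(\<lambda>s. (t - s) powr (\<alpha> t - 1)) \<in> borel_measurable (lebesgue_on {0..t})"
    by (intro measurable_restrict_space1 measurable_completion)
  show ?thesis
    unfolding RL_integrand_def[abs_def] by measurable
qed

lemma integral_RL_integrand_eq_borel:
  assumes f: "f \<in> borel_measurable (lebesgue_on {0..1})" and [measurable]: "g \<in> borel_measurable borel"
    and eq: "AE s in lborel. s \<in> {0..1} \<longrightarrow> f s = g s" and t: "t \<le> 1"
  shows "(LINT s|lebesgue_on {0..t}. RL_integrand \<alpha> f t s)
    = (\<integral>s. (if 0 \<le> s \<and> s \<le> t then (t - s) powr (\<alpha> t - 1) * g s else 0) \<partial>lborel)"
proof -
  have g: "(\<lambda>s. if 0 \<le> s \<and> s \<le> t then (t - s) powr (\<alpha> t - 1) * g s else 0) \<in> borel_measurable lborel"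
    by measurable
  have "(LINT s|lebesgue_on {0..t}. RL_integrand \<alpha> f t s)
    = (LINT s|lebesgue. (if s \<in> {0..t} then RL_integrand \<alpha> f t s else 0))"
    by (subst integral_restrict_space) (auto intro!: Bochner_Integration.integral_cong)
  also have "\<dots> = (LINT s|lebesgue. (if 0 \<le> s \<and> s \<le> t then (t - s) powr (\<alpha> t - 1) * g s else 0))"
  proof (rule integral_cong_AE)
    show "(\<lambda>s. if s \<in> {0..t} then RL_integrand \<alpha> f t s else 0) \<in> borel_measurable lebesgue"
      using RL_integrand_measurable[OF f t] by (subst borel_measurable_if) auto
    show "(\<lambda>s. if 0 \<le> s \<and> s \<le> t then (t - s) powr (\<alpha> t - 1) * g s else 0) \<in> borel_measurable lebesgue"
      using g by (rule measurable_completion)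
    show "AE s in lebesgue. (if s \<in> {0..t} then RL_integrand \<alpha> f t s else 0)
        = (if 0 \<le> s \<and> s \<le> t then (t - s) powr (\<alpha> t - 1) * g s else 0)"
      using AE_completion[OF eq] by eventually_elim (use t in \<open>auto simp: RL_integrand_def\<close>)
  qed
  also have "\<dots> = (\<integral>s. (if 0 \<le> s \<and> s \<le> t then (t - s) powr (\<alpha> t - 1) * g s else 0) \<partial>lborel)"
    using g by (rule integral_completion)
  finally show ?thesis .
qed

text \<open>
  The variable order and the function are replaced by Borel representatives, for which the
  parametrised integral depends measurably on \<open>t\<close>; completeness of Lebesgue measure carries the result back.
\<close>

lemma RL_measurable:
  assumes \<alpha>: "\<alpha> \<in> borel_measurable (lebesgue_on {0..1})"
    and pos: "AE t in lebesgue_on {0..1}. 0 < \<alpha> t"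
    and f: "f \<in> borel_measurable (lebesgue_on {0..1})"
  shows "RL \<alpha> f \<in> borel_measurable (lebesgue_on {0..1})"
proof -
  obtain g where [measurable]: "g \<in> borel_measurable borel"
    and g: "AE s in lborel. s \<in> {0..1} \<longrightarrow> f s = g s"
    using borel_representative[OF f] by blast
  obtain a where [measurable]: "a \<in> borel_measurable borel"
    and a: "AE t in lborel. t \<in> {0..1} \<longrightarrow> \<alpha> t = a t"
    using borel_representative[OF \<alpha>] by blast
  \<comment> \<open>The restriction of \<open>Gamma\<close> to positive arguments, where it is continuous.\<close>
  define G where "G = (\<lambda>x. indicator {0<..} x *\<^sub>R Gamma x :: real)"
  have [measurable]: "G \<in> borel_measurable borel"
    unfolding G_def by (intro borel_measurable_continuous_on_indicator continuous_on_Gamma continuous_on_id)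
      (auto elim!: nonpos_Ints_cases)
  define R where "R t = (if t \<in> {0..1} then 1 / G (a t) *
      (\<integral>s. (if 0 \<le> s \<and> s \<le> t then (t - s) powr (a t - 1) * g s else 0) \<partial>lborel) else 0)" for t
  have [measurable]: "(\<lambda>t. \<integral>s. (if 0 \<le> s \<and> s \<le> t then (t - s) powr (a t - 1) * g s else 0) \<partial>lborel) \<in> borel_measurable borel"
    by (rule lborel.borel_measurable_lebesgue_integral) measurable
  have R: "R \<in> borel_measurable lebesgue"
    unfolding R_def by (intro measurable_completion) measurable
  have "AE t in lebesgue. R t = (if t \<in> {0..1} then RL \<alpha> f t else 0)"
    using AE_completion[OF a] AE_completion[OF pos[unfolded AE_lebesgue_on_Icc_iff]]
  proof eventually_elim
    case (elim t)
    show ?case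
    proof (cases "t \<in> {0..1}")
      case True
      with elim have "\<alpha> t = a t" "0 < a t" by auto
      then show ?thesis
        using True integral_RL_integrand_eq_borel[OF f _ g, of t \<alpha>] by (simp add: R_def RL_def G_def cong: if_cong)
    qed (auto simp: R_def)
  qed
  from borel_measurable_AE[OF R this] show ?thesis
    by (subst (asm) borel_measurable_if) auto
qed

lemma RL_pointwise:
  assumes f: "f \<in> borel_measurable (lebesgue_on {0..1})"
    and g: "AE s in lborel. s \<in> {0..1} \<longrightarrow> \<bar>f s\<bar> = g s" and t: "t \<in> {0..1}" and "0 < \<alpha> t"
    and le: "RL_nn (\<alpha> t) g t \<le> ennreal (Gamma (\<alpha> t) * m)" and "0 \<le> m"
  shows "RL_exists \<alpha> f t" and "\<bar>RL \<alpha> f t\<bar> \<le> m"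
proof -
  have "(\<integral>\<^sup>+s. ennreal (norm (RL_integrand \<alpha> f t s)) \<partial>lebesgue_on {0..t}) \<le> RL_nn (\<alpha> t) g t"
    unfolding nn_integral_lebesgue_on_Icc RL_nn_def
  proof (rule nn_integral_mono_AE)
    show "AE s in lborel. ennreal (norm (RL_integrand \<alpha> f t s)) * indicator {0..t} s
        \<le> ennreal ((t - s) powr (\<alpha> t - 1)) * ennreal (g s) * indicator {..<t} s"
      using g
    proof eventually_elim
      case (elim s)
      show ?case
      proof (cases "0 \<le> s \<and> s < t")
        case True
        with elim t have "g s = \<bar>f s\<bar>" by auto
        then show ?thesis
          using True by (simp add: RL_integrand_def abs_mult ennreal_mult)
      next
        case False
        \<comment> \<open>at \<open>s = t\<close> the integrand vanishes, since \<open>0 powr a = 0\<close>\<close>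
        then show ?thesis by (auto simp: RL_integrand_def indicator_def)
      qed
    qed
  qed
  then have fin: "(\<integral>\<^sup>+s. ennreal (norm (RL_integrand \<alpha> f t s)) \<partial>lebesgue_on {0..t}) \<le> ennreal (Gamma (\<alpha> t) * m)"
    using le by (rule order_trans)
  have int: "integrable (lebesgue_on {0..t}) (RL_integrand \<alpha> f t)"
  proof (rule integrableI_bounded)
    show "RL_integrand \<alpha> f t \<in> borel_measurable (lebesgue_on {0..t})"
      using t by (intro RL_integrand_measurable f) auto
    show "(\<integral>\<^sup>+s. ennreal (norm (RL_integrand \<alpha> f t s)) \<partial>lebesgue_on {0..t}) < \<infinity>"
      using fin by (rule order.strict_trans1) simp
  qed
  then show "RL_exists \<alpha> f t"
    by (simp add: RL_exists_def)
  have "0 < Gamma (\<alpha> t)"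
    using \<open>0 < \<alpha> t\<close> by (rule Gamma_real_pos)
  have "ennreal \<bar>LINT s|lebesgue_on {0..t}. RL_integrand \<alpha> f t s\<bar> \<le> ennreal (Gamma (\<alpha> t) * m)"
    using order_trans[OF integral_norm_bound_ennreal[OF int] fin] by simp
  then have "\<bar>LINT s|lebesgue_on {0..t}. RL_integrand \<alpha> f t s\<bar> \<le> Gamma (\<alpha> t) * m"
    using \<open>0 < Gamma (\<alpha> t)\<close> \<open>0 \<le> m\<close> by simp
  then show "\<bar>RL \<alpha> f t\<bar> \<le> m"
    using \<open>0 < Gamma (\<alpha> t)\<close> by (simp add: RL_def abs_mult field_simps)
qed

lemma RL_bound_finite_exponents:
  fixes p q :: real
  assumes "1 < p" "1 \<le> q"
    and pos: "AE t in lebesgue_on {0..1}. 0 < \<alpha> t \<and> 1 / p - 1 / q < \<alpha> t"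
  obtains K where "0 \<le> K"
    and "\<And>f N. \<lbrakk>f \<in> borel_measurable (lebesgue_on {0..1}); 0 < N;
        (\<integral>\<^sup>+s. ennreal (\<bar>f s\<bar> powr p) \<partial>lebesgue_on {0..1}) \<le> ennreal (N powr p)\<rbrakk>
      \<Longrightarrow> (AE t in lebesgue_on {0..1}. RL_exists \<alpha> f t) \<and>
          (\<integral>\<^sup>+t. ennreal (\<bar>RL \<alpha> f t\<bar> powr q) \<partial>lebesgue_on {0..1}) \<le> ennreal (K * N powr q)"
proof -
  from RL_nn_majorant[OF assms(1,2)] obtain K where "0 \<le> K" and K:
    "\<And>g N. \<lbrakk>g \<in> borel_measurable borel; \<And>s. 0 \<le> g s; \<And>s. s \<notin> {0..1} \<Longrightarrow> g s = 0; 0 < N;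
        (\<integral>\<^sup>+s. ennreal (g s powr p) \<partial>lborel) \<le> ennreal (N powr p)\<rbrakk>
      \<Longrightarrow> \<exists>m\<in>borel_measurable borel. (\<forall>t. 0 \<le> m t) \<and>
          (\<integral>\<^sup>+t\<in>{0..1}. ennreal (m t powr q) \<partial>lborel) \<le> ennreal (K * N powr q) \<and>
          (AE t in lborel. t \<le> 1 \<longrightarrow>
            (\<forall>a>0. 1 / p - 1 / q < a \<longrightarrow> RL_nn a g t \<le> ennreal (Gamma a * m t)))"
    by blast
  show thesis
  proof (rule that[OF \<open>0 \<le> K\<close>])
    fix f :: "real \<Rightarrow> real" and N :: real
    assume f: "f \<in> borel_measurable (lebesgue_on {0..1})" and "0 < N"
      and N: "(\<integral>\<^sup>+s. ennreal (\<bar>f s\<bar> powr p) \<partial>lebesgue_on {0..1}) \<le> ennreal (N powr p)"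
    obtain g0 where [measurable]: "g0 \<in> borel_measurable borel" and supp: "\<And>s. s \<notin> {0..1} \<Longrightarrow> g0 s = 0"
      and g0: "AE s in lborel. s \<in> {0..1} \<longrightarrow> f s = g0 s"
      using borel_representative[OF f] by blast
    define g where "g s = \<bar>g0 s\<bar>" for s
    have g: "AE s in lborel. s \<in> {0..1} \<longrightarrow> \<bar>f s\<bar> = g s"
      using g0 by eventually_elim (auto simp: g_def)
    have "(\<integral>\<^sup>+s. ennreal (g s powr p) \<partial>lborel) = (\<integral>\<^sup>+s. ennreal (\<bar>f s\<bar> powr p) \<partial>lebesgue_on {0..1})"
      unfolding nn_integral_lebesgue_on_Icc
      by (rule nn_integral_cong_AE) (use g in eventually_elim, auto simp: indicator_def g_def supp)
    with N have N': "(\<integral>\<^sup>+s. ennreal (g s powr p) \<partial>lborel) \<le> ennreal (N powr p)"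
      by simp
    have [measurable]: "g \<in> borel_measurable borel"
      unfolding g_def by measurable
    have g_nonneg: "0 \<le> g s" and g_supp: "s \<notin> {0..1} \<Longrightarrow> g s = 0" for s
      by (auto simp: g_def supp)
    obtain m where m: "\<And>t. 0 \<le> m t"
        "(\<integral>\<^sup>+t\<in>{0..1}. ennreal (m t powr q) \<partial>lborel) \<le> ennreal (K * N powr q)"
        "AE t in lborel. t \<le> 1 \<longrightarrow>
            (\<forall>a>0. 1 / p - 1 / q < a \<longrightarrow> RL_nn a g t \<le> ennreal (Gamma a * m t))"
      using K[OF \<open>g \<in> borel_measurable borel\<close> g_nonneg g_supp \<open>0 < N\<close> N'] by blast
    have *: "AE t in lborel. t \<in> {0..1} \<longrightarrow> RL_exists \<alpha> f t \<and> \<bar>RL \<alpha> f t\<bar> \<le> m t"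
      using m(3) pos[unfolded AE_lebesgue_on_Icc_iff]
    proof eventually_elim
      case (elim t)
      show ?case
      proof
        assume t: "t \<in> {0..1}"
        with elim have "0 < \<alpha> t" "RL_nn (\<alpha> t) g t \<le> ennreal (Gamma (\<alpha> t) * m t)"
          by auto
        from RL_pointwise[of f g t \<alpha> "m t", OF f g t this m(1)] show "RL_exists \<alpha> f t \<and> \<bar>RL \<alpha> f t\<bar> \<le> m t"
          by blast
      qed
    qed
    have "AE t in lebesgue_on {0..1}. RL_exists \<alpha> f t"
      unfolding AE_lebesgue_on_Icc_iff using * by eventually_elim blast
    moreover have "(\<integral>\<^sup>+t. ennreal (\<bar>RL \<alpha> f t\<bar> powr q) \<partial>lebesgue_on {0..1})
        \<le> (\<integral>\<^sup>+t\<in>{0..1}. ennreal (m t powr q) \<partial>lborel)"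
      unfolding nn_integral_lebesgue_on_Icc
    proof (rule nn_integral_mono_AE)
      show "AE t in lborel. ennreal (\<bar>RL \<alpha> f t\<bar> powr q) * indicator {0..1} t
          \<le> ennreal (m t powr q) * indicator {0..1} t"
        using * by eventually_elim
          (use assms in \<open>auto simp: indicator_def intro!: ennreal_leI powr_mono2\<close>)
    qed
    ultimately show "(AE t in lebesgue_on {0..1}. RL_exists \<alpha> f t) \<and>
          (\<integral>\<^sup>+t. ennreal (\<bar>RL \<alpha> f t\<bar> powr q) \<partial>lebesgue_on {0..1}) \<le> ennreal (K * N powr q)"
      using m(2) by (auto intro: order_trans)
  qed
qed

section \<open>Boundedness between Lebesgue spaces\<close>

text \<open>
  For \<open>p = \<infinity>\<close> this uses that the interval is not a null set.
\<close>

lemma Lp_norm_nonneg: "0 \<le> Lp_norm (lebesgue_on {0..1::real}) p f"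
proof (cases "p = \<infinity>")
  case True
  have "0 \<le> esssup (lebesgue_on {0..1::real}) (\<lambda>x. ereal \<bar>f x\<bar>)"
  proof (rule ccontr)
    assume *: "\<not> ?thesis"
    have "AE x in lebesgue_on {0..1::real}. ereal \<bar>f x\<bar> \<le> esssup (lebesgue_on {0..1}) (\<lambda>x. ereal \<bar>f x\<bar>)"
      by (rule esssup_AE)
    then have "AE x in lebesgue_on {0..1::real}. False"
    proof eventually_elim
      case (elim x)
      have "0 \<le> ereal \<bar>f x\<bar>" by simp
      with elim * show False by (meson order_trans)
    qed
    then have "AE x in lborel. x \<notin> {0..1::real}"
      unfolding AE_lebesgue_on_Icc_iff by simp
    then have "{0..1::real} \<in> null_sets lborel"
      by (simp add: AE_iff_null_sets)
    then show False by (simp add: null_sets_def)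
  qed
  then show ?thesis
    using True by (simp add: Lp_norm_def real_of_ereal_pos)
qed (simp add: Lp_norm_def)

text \<open>
  For \<open>p = \<infinity>\<close> the exponent \<open>r\<close> is any positive number, as the interval has length \<open>1\<close>.
\<close>

lemma Lp_space_nn_integral_le:
  assumes f: "f \<in> Lp_space (lebesgue_on {0..1::real}) p" and "1 < p" and "0 < N"
    and N: "Lp_norm (lebesgue_on {0..1}) p f \<le> N"
    and r: "if p = \<infinity> then 0 < r else p = ereal r"
  shows "(\<integral>\<^sup>+s. ennreal (\<bar>f s\<bar> powr r) \<partial>lebesgue_on {0..1}) \<le> ennreal (N powr r)"
proof (cases "p = \<infinity>")
  case True
  define E where "E = esssup (lebesgue_on {0..1}) (\<lambda>x. ereal \<bar>f x\<bar>)"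
  have "E < \<infinity>" "real_of_ereal E \<le> N"
    using f N True by (auto simp: E_def Lp_space_def Lp_norm_def)
  then have "E \<le> ereal N"
    using \<open>0 < N\<close> by (cases E) auto
  have "AE x in lebesgue_on {0..1}. ereal \<bar>f x\<bar> \<le> E"
    unfolding E_def by (rule esssup_AE)
  then have ae: "AE x in lborel. x \<in> {0..1} \<longrightarrow> \<bar>f x\<bar> \<le> N"
    unfolding AE_lebesgue_on_Icc_iff
    by eventually_elim (use \<open>E \<le> ereal N\<close> order_trans in fastforce)
  have "(\<integral>\<^sup>+s. ennreal (\<bar>f s\<bar> powr r) \<partial>lebesgue_on {0..1})
      \<le> (\<integral>\<^sup>+s. ennreal (N powr r) * indicator {0..1::real} s \<partial>lborel)"
    unfolding nn_integral_lebesgue_on_Icc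
    by (rule nn_integral_mono_AE, use ae in eventually_elim)
      (use r True in \<open>auto simp: indicator_def intro!: ennreal_leI powr_mono2\<close>)
  also have "\<dots> = ennreal (N powr r)"
    by (simp add: nn_integral_cmult_indicator)
  finally show ?thesis .
next
  case False
  then have p: "p = ereal r" and "1 < r" using r \<open>1 < p\<close> by auto
  have int: "integrable (lebesgue_on {0..1}) (\<lambda>s. \<bar>f s\<bar> powr r)"
    using f p by (simp add: Lp_space_def)
  define I where "I = (LINT s|lebesgue_on {0..1}. \<bar>f s\<bar> powr r)"
  have "0 \<le> I" unfolding I_def by (rule integral_nonneg_AE) simp
  have "I powr (1 / r) \<le> N"
    using N p by (simp add: Lp_norm_def I_def)
  then have "(I powr (1 / r)) powr r \<le> N powr r"
    using \<open>1 < r\<close> by (intro powr_mono2) auto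
  then have "I \<le> N powr r"
    using \<open>0 \<le> I\<close> \<open>1 < r\<close> by (simp add: powr_powr)
  moreover have "(\<integral>\<^sup>+s. ennreal (\<bar>f s\<bar> powr r) \<partial>lebesgue_on {0..1}) = ennreal I"
    unfolding I_def by (rule nn_integral_eq_integral[OF int]) simp
  ultimately show ?thesis by (simp add: ennreal_leI)
qed

lemma Lp_spaceI_nn_integral_le:
  fixes q :: real
  assumes [measurable]: "h \<in> borel_measurable M" and "0 < q" "0 \<le> K" "0 < N"
    and le: "(\<integral>\<^sup>+t. ennreal (\<bar>h t\<bar> powr q) \<partial>M) \<le> ennreal (K * N powr q)"
  shows "h \<in> Lp_space M (ereal q)" and "Lp_norm M (ereal q) h \<le> K powr (1 / q) * N"
proof -
  have "integrable M (\<lambda>t. \<bar>h t\<bar> powr q)"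
    by (rule integrableI_bounded) (use order.strict_trans1[OF le] in auto)
  then show "h \<in> Lp_space M (ereal q)"
    by (simp add: Lp_space_def)
  have "(LINT t|M. \<bar>h t\<bar> powr q) \<le> K * N powr q"
    using le \<open>0 \<le> K\<close> by (intro integral_real_bounded) auto
  then have "(LINT t|M. \<bar>h t\<bar> powr q) powr (1 / q) \<le> (K * N powr q) powr (1 / q)"
    using \<open>0 < q\<close> by (intro powr_mono2 integral_nonneg_AE) auto
  also have "\<dots> = K powr (1 / q) * N"
    using assms by (simp add: powr_mult powr_powr)
  finally show "Lp_norm M (ereal q) h \<le> K powr (1 / q) * N"
    by (simp add: Lp_norm_def)
qed

theorem proposition3p7:
  fixes p q :: ereal and \<alpha> :: "real \<Rightarrow> real"
  assumes "1 < p" and "p \<le> \<infinity>" and "1 \<le> q" and "q < \<infinity>"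
    and "\<alpha> \<in> borel_measurable (lebesgue_on {0..1})"
    and "\<And>t. t \<in> {0..1} \<Longrightarrow> 0 \<le> \<alpha> t"
    and "AE t in lebesgue_on {0..1}. 0 < \<alpha> t \<and> max (1 / p - 1 / q) 0 < ereal (\<alpha> t)"
  shows "(\<forall>f\<in>Lp_space (lebesgue_on {0..1}) p. AE t in lebesgue_on {0..1}. RL_exists \<alpha> f t) \<and>
         bounded_Lp_operator (lebesgue_on {0..1}) p (lebesgue_on {0..1}) q (RL \<alpha>)"
proof -
  let ?I = "lebesgue_on {0..1::real}"
  obtain q' where q: "q = ereal q'" "1 \<le> q'"
    using assms(3,4) by (cases q) auto
  \<comment> \<open>For \<open>p = \<infinity>\<close> the finite exponent \<open>max 2 q\<close> serves instead: it is at least \<open>q\<close>, so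
     that no lower bound on the order beyond positivity is required.\<close>
  obtain r where r: "if p = \<infinity> then r = max 2 q' else p = ereal r"
    using assms(1) by (cases p) auto
  have "1 < r"
    using r assms(1) by (auto split: if_splits)
  have r': "if p = \<infinity> then 0 < r else p = ereal r"
    using r \<open>1 < r\<close> by (auto split: if_splits)
  have pos: "AE t in ?I. 0 < \<alpha> t \<and> 1 / r - 1 / q' < \<alpha> t"
    using assms(7)
  proof eventually_elim
    case (elim t)
    show ?case
    proof (cases "p = \<infinity>")
      case True
      then have "1 / r \<le> 1 / q'"
        using r q by (auto simp: field_simps)
      then show ?thesis using elim by linarith
    next
      case False
      then show ?thesis using elim r q \<open>1 < r\<close> by (auto simp: one_ereal_def)
    qed
  qed
  then have \<alpha>_pos: "AE t in ?I. 0 < \<alpha> t"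
    by eventually_elim simp
  from RL_bound_finite_exponents[OF \<open>1 < r\<close> q(2) pos] obtain K where "0 \<le> K" and K:
    "\<And>f N. \<lbrakk>f \<in> borel_measurable ?I; 0 < N;
        (\<integral>\<^sup>+s. ennreal (\<bar>f s\<bar> powr r) \<partial>?I) \<le> ennreal (N powr r)\<rbrakk>
      \<Longrightarrow> (AE t in ?I. RL_exists \<alpha> f t) \<and>
          (\<integral>\<^sup>+t. ennreal (\<bar>RL \<alpha> f t\<bar> powr q') \<partial>?I) \<le> ennreal (K * N powr q')"
    by blast
  have bound: "(AE t in ?I. RL_exists \<alpha> f t) \<and> RL \<alpha> f \<in> Lp_space ?I q \<and> Lp_norm ?I q (RL \<alpha> f) \<le> K powr (1 / q') * N"
    if f: "f \<in> Lp_space ?I p" and N: "Lp_norm ?I p f < N" for f N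
  proof -
    have meas: "f \<in> borel_measurable ?I" using f by (simp add: Lp_space_def)
    have "0 < N" using Lp_norm_nonneg N by (rule order.strict_trans1)
    have "(\<integral>\<^sup>+s. ennreal (\<bar>f s\<bar> powr r) \<partial>?I) \<le> ennreal (N powr r)"
      by (rule Lp_space_nn_integral_le[OF f assms(1) \<open>0 < N\<close> _ r']) (use N in simp)
    note * = K[OF meas \<open>0 < N\<close> this]
    note ** = Lp_spaceI_nn_integral_le[OF RL_measurable[OF assms(5) \<alpha>_pos meas] _ \<open>0 \<le> K\<close> \<open>0 < N\<close> conjunct2[OF *]]
    show ?thesis using * ** q by auto
  qed
  have ex: "AE t in ?I. RL_exists \<alpha> f t" and space: "RL \<alpha> f \<in> Lp_space ?I q" if "f \<in> Lp_space ?I p" for f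
    using bound[OF that, of "Lp_norm ?I p f + 1"] by auto
  have norm: "Lp_norm ?I q (RL \<alpha> f) \<le> K powr (1 / q') * Lp_norm ?I p f" if f: "f \<in> Lp_space ?I p" for f
  \<comment> \<open>The bound is known for every \<open>N\<close> above the norm of \<open>f\<close>, which covers functions of norm \<open>0\<close>.\<close>
  proof (rule field_le_epsilon)
    fix e :: real assume "0 < e"
    define d where "d = e / (K powr (1 / q') + 1)"
    have K_pos: "0 < K powr (1 / q') + 1"
      by (simp add: add_nonneg_pos)
    then have "0 < d" using \<open>0 < e\<close> by (simp add: d_def)
    have "Lp_norm ?I q (RL \<alpha> f) \<le> K powr (1 / q') * (Lp_norm ?I p f + d)"
      using bound[OF f, of "Lp_norm ?I p f + d"] \<open>0 < d\<close> by simp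
    also have "\<dots> \<le> K powr (1 / q') * Lp_norm ?I p f + (K powr (1 / q') + 1) * d"
      using \<open>0 < d\<close> by (simp add: algebra_simps)
    also have "(K powr (1 / q') + 1) * d = e"
      using K_pos by (simp add: d_def)
    finally show "Lp_norm ?I q (RL \<alpha> f) \<le> K powr (1 / q') * Lp_norm ?I p f + e" .
  qed
  have add: "AE t in ?I. RL \<alpha> (\<lambda>x. f x + g x) t = RL \<alpha> f t + RL \<alpha> g t"
    if "f \<in> Lp_space ?I p" "g \<in> Lp_space ?I p" for f g
    using ex[OF that(1)] ex[OF that(2)]
    by eventually_elim
      (simp add: RL_def RL_exists_def RL_integrand_def[abs_def] distrib_left Bochner_Integration.integral_add)
  have scale: "RL \<alpha> (\<lambda>x. c * f x) t = c * RL \<alpha> f t" for c f t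
  proof -
    have "RL_integrand \<alpha> (\<lambda>x. c * f x) t = (\<lambda>s. c * RL_integrand \<alpha> f t s)"
      by (auto simp: RL_integrand_def)
    then show ?thesis by (simp add: RL_def)
  qed
  show ?thesis
    unfolding bounded_Lp_operator_def using ex space norm add scale by auto
qed

end
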